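(* Let $L_1,L_2>0$, $\Omega=(0,L_1)\times(0,L_2)$, $n\ge1$ an integer, $\Lambda=\mathrm{diag}(\lambda_1,\dots,\lambda_n)$ a nonsingular real diagonal matrix, and $M_1,M_2,Q$ nonsingular real $n\times n$ matrices with $Q^{-1}\Lambda Q=M_2^{-1}M_1$. For each $i$ let $\Gamma^i$ be $\Gamma_W\cup\Gamma_S$ or $\Gamma_E\cup\Gamma_N$ if $\lambda_i>0$, and $\Gamma_W\cup\Gamma_N$ or $\Gamma_E\cup\Gamma_S$ if $\lambda_i<0$. Let $\mathcal{X}_{\vec\Gamma}(\Omega)=\{\Theta\in L^2(\Omega)^n:\ M_1\Theta_x+M_2\Theta_y\in L^2(\Omega)^n,\ (Q\Theta)_i|_{\Gamma^i}=0 \text{ for } i=1,\dots,n\}$ with norm $(\|\Theta\|_{L^2}^2+\|M_1\Theta_x+M_2\Theta_y\|_{L^2}^2)^{1/2}$, and $\mathcal{V}_{\vec\Gamma}(\Omega)=\{\Theta\in\mathcal{C}^\infty(\overline\Omega)^n:\ (Q\Theta)_i \text{ vanishes in a neighborhood of }\Gamma^i \text{ for each } i\}$. Then $\mathcal{V}_{\vec\Gamma}(\Omega)\cap\mathcal{X}_{\vec\Gamma}(\Omega)$ is dense in $\mathcal{X}_{\vec\Gamma}(\Omega)$.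
   Context: $\Gamma_W=\{x=0\}$, $\Gamma_E=\{x=L_1\}$, $\Gamma_S=\{y=0\}$, $\Gamma_N=\{y=L_2\}$. Derivatives are in the sense of distributions; the boundary conditions are understood in the sense of traces, which exist in $H^{-1}$ of each side for functions in the indicated space. *)

theory Defs
  imports "HOL-Analysis.Analysis"
begin

definition Omega :: "real \<Rightarrow> real \<Rightarrow> (real \<times> real) set" where
  "Omega L1 L2 = {0<..<L1} \<times> {0<..<L2}"

definition OmegaBar :: "real \<Rightarrow> real \<Rightarrow> (real \<times> real) set" where
  "OmegaBar L1 L2 = {0..L1} \<times> {0..L2}"

datatype side = West | East | South | North

fun side_set :: "real \<Rightarrow> real \<Rightarrow> side \<Rightarrow> (real \<times> real) set" where
  "side_set L1 L2 West  = {0} \<times> {0..L2}"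
| "side_set L1 L2 East  = {L1} \<times> {0..L2}"
| "side_set L1 L2 South = {0..L1} \<times> {0}"
| "side_set L1 L2 North = {0..L1} \<times> {L2}"

definition smooth2 :: "(real \<times> real \<Rightarrow> real) \<Rightarrow> bool" where
  "smooth2 f \<longleftrightarrow> (\<exists>D :: nat \<Rightarrow> nat \<Rightarrow> (real \<times> real \<Rightarrow> real).
      D 0 0 = f \<and>
      (\<forall>a b. continuous_on UNIV (D a b) \<and>
         (\<forall>p. (D a b has_derivative
                 (\<lambda>h. fst h * D (Suc a) b p + snd h * D a (Suc b) p)) (at p))))"

definition smooth2_vec :: "(real \<times> real \<Rightarrow> real ^ 'n) \<Rightarrow> bool" where
  "smooth2_vec F \<longleftrightarrow> (\<forall>i. smooth2 (\<lambda>p. F p $ i))"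

definition dx :: "(real \<times> real \<Rightarrow> real) \<Rightarrow> real \<times> real \<Rightarrow> real" where
  "dx f p = deriv (\<lambda>t. f (t, snd p)) (fst p)"

definition dy :: "(real \<times> real \<Rightarrow> real) \<Rightarrow> real \<times> real \<Rightarrow> real" where
  "dy f p = deriv (\<lambda>t. f (fst p, t)) (snd p)"

definition supp :: "(real \<times> real \<Rightarrow> real) \<Rightarrow> (real \<times> real) set" where
  "supp f = closure {p. f p \<noteq> 0}"

definition L2_on :: "(real \<times> real) set \<Rightarrow> (real \<times> real \<Rightarrow> real ^ 'n) \<Rightarrow> bool" where
  "L2_on S F \<longleftrightarrow> set_borel_measurable lborel S F \<and>
                  set_integrable lborel S (\<lambda>p. (norm (F p))\<^sup>2)"

definition diag_mat :: "real ^ 'n \<Rightarrow> real ^ 'n ^ 'n" where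
  "diag_mat lam = (\<chi> i j. if i = j then lam $ i else 0)"

definition weak_op :: "real \<Rightarrow> real \<Rightarrow> real^'n^'n \<Rightarrow> real^'n^'n
     \<Rightarrow> (real \<times> real \<Rightarrow> real ^ 'n) \<Rightarrow> (real \<times> real \<Rightarrow> real ^ 'n) \<Rightarrow> bool" where
  "weak_op L1 L2 M1 M2 Th G \<longleftrightarrow>
     (\<forall>\<phi>. smooth2 \<phi> \<and> compact (supp \<phi>) \<and> supp \<phi> \<subseteq> Omega L1 L2 \<longrightarrow>
        (LINT p:Omega L1 L2|lborel. \<phi> p *\<^sub>R G p) =
        - (LINT p:Omega L1 L2|lborel. dx \<phi> p *\<^sub>R (M1 *v Th p) + dy \<phi> p *\<^sub>R (M2 *v Th p)))"

text \<open>Vanishing of the trace of u on (the relative interior of) side s, where u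
  satisfies lam u_x + u_y = g in L2 (distributionally).  The trace, an element of
  H^{-1} of the side, is defined through Green's formula: for test functions phi
  smooth up to the boundary and vanishing near the three other closed sides,
  the boundary term  int_side u phi (lam n_x + n_y) equals
  int_Omega (u (lam phi_x + phi_y) + g phi);  since lam n_x + n_y is a nonzero
  constant on each side, the trace vanishes iff this is zero for all such phi.\<close>
definition trace_zero :: "real \<Rightarrow> real \<Rightarrow> real \<Rightarrow> (real \<times> real \<Rightarrow> real)
     \<Rightarrow> (real \<times> real \<Rightarrow> real) \<Rightarrow> side \<Rightarrow> bool" where
  "trace_zero L1 L2 lam u g s \<longleftrightarrow>
     (\<forall>\<phi>. smooth2 \<phi> \<and> compact (supp \<phi>) \<and>
           supp \<phi> \<inter> (\<Union>s'\<in>UNIV - {s}. side_set L1 L2 s') = {} \<longrightarrow>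
        (LINT p:Omega L1 L2|lborel. u p * (lam * dx \<phi> p + dy \<phi> p) + g p * \<phi> p) = 0)"

text \<open>Membership of Theta in X_Gamma(Omega), with G = M1 Theta_x + M2 Theta_y.
  Note (Q M2^{-1} G)_i = lam_i ((Q Theta)_i)_x + ((Q Theta)_i)_y distributionally,
  because Q M2^{-1} M1 = Lambda Q.\<close>
definition inX :: "real \<Rightarrow> real \<Rightarrow> real^'n^'n \<Rightarrow> real^'n^'n \<Rightarrow> real^'n^'n \<Rightarrow> real^'n
     \<Rightarrow> ('n \<Rightarrow> side set) \<Rightarrow> (real \<times> real \<Rightarrow> real ^ 'n) \<Rightarrow> (real \<times> real \<Rightarrow> real ^ 'n) \<Rightarrow> bool" where
  "inX L1 L2 M1 M2 Q lam Gam Th G \<longleftrightarrow>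
     L2_on (Omega L1 L2) Th \<and> L2_on (Omega L1 L2) G \<and> weak_op L1 L2 M1 M2 Th G \<and>
     (\<forall>i. \<forall>s\<in>Gam i. trace_zero L1 L2 (lam $ i) (\<lambda>p. (Q *v Th p) $ i)
                         (\<lambda>p. (Q *v (matrix_inv M2 *v G p)) $ i) s)"

text \<open>V_Gamma(Omega): restrictions to the closed rectangle of C-infinity functions on
  the plane such that (Q Theta)_i vanishes (in the closed rectangle) on a
  neighbourhood of Gamma^i.\<close>
definition inV :: "real \<Rightarrow> real \<Rightarrow> real^'n^'n \<Rightarrow> ('n \<Rightarrow> side set)
     \<Rightarrow> (real \<times> real \<Rightarrow> real ^ 'n) \<Rightarrow> bool" where
  "inV L1 L2 Q Gam Th \<longleftrightarrow> smooth2_vec Th \<and>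
     (\<forall>i. \<exists>U. open U \<and> (\<Union>s\<in>Gam i. side_set L1 L2 s) \<subseteq> U \<and>
            (\<forall>p\<in>U \<inter> OmegaBar L1 L2. (Q *v Th p) $ i = 0))"

end

theory Submission
  imports Defs
begin

text \<open>
  In the variables \<open>u = (Q \<Theta>)\<^sub>i\<close>, \<open>g = (Q M\<^sub>2\<^sup>-\<^sup>1 G)\<^sub>i\<close> the system decouples into scalar equations
  \<open>\<lambda> u\<^sub>x + u\<^sub>y = g\<close> with \<open>u\<close> vanishing on two adjacent sides.  Green's formula then holds for every test
  function that vanishes near the other two sides, whatever its values at the corner opposite to those: the
  contribution of that corner is cut off by functions with gradient of order \<open>1/r\<close> on a square of area of order
  \<open>r\<^sup>2\<close>, which is harmless for \<open>u \<in> L\<^sup>2\<close>.  Hence the extension of \<open>u\<close> by zero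
  across \<open>\<Gamma>\<close> still solves the equation there.  Mollifying it with a kernel supported away from the
  origin, on the side that looks into the rectangle, shifts it away from \<open>\<Gamma>\<close> and makes it smooth
  at the same time, and commutes with the differential operator.
\<close>

subsection \<open>Smooth functions of one variable\<close>

text \<open>Vanishing of a trace is tested one side at a time, with functions that vanish near the
  whole of the other three sides, corners included. The corner common to the two sides of
  \<open>\<Gamma>\<close> is therefore seen by neither condition. The loss there is exactly
  critical: gradient times square root of area stays bounded, and the limit is 0 only because the
  square mass of the data on the shrinking squares tends to 0. The kernel is a product of
  one-variable kernels, each supported in \<open>[r, 2r]\<close> along an inner normal. This one
  choice does two jobs. The convolution at \<open>p\<close> uses only points displaced from
  \<open>p\<close> towards \<open>\<Gamma>\<close>, so within distance \<open>r\<close> of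
  \<open>\<Gamma>\<close> it sees only the zero extension; and from a point \<open>p\<close> of the
  rectangle it never sees the opposite sides, so that Green's formula is available at every such
  \<open>p\<close>, with no restriction on \<open>r\<close>. Since the kernel is a product, so are
  all test functions. Cut-offs then act in one variable and remove neighbourhoods of lines, and
  smoothness is needed first for functions of one variable.\<close>

definition smooth1 :: "(real \<Rightarrow> real) \<Rightarrow> bool" where
  "smooth1 f \<longleftrightarrow> (\<forall>n x. ((deriv ^^ n) f has_real_derivative (deriv ^^ Suc n) f x) (at x))"

text \<open>Derivatives are unique, so all iterates of \<open>deriv\<close> stay inside
  \<open>S\<close>. Closure properties of \<open>smooth1\<close> then require an invariant family of
  functions instead of a formula for the \<open>n\<close>-th derivative. The iterates themselves
  become the witnesses \<open>D a b\<close> of \<open>smooth2\<close>.\<close>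

lemma smooth1_coinduct:
  assumes "f \<in> S"
    and step: "\<And>g. g \<in> S \<Longrightarrow> \<exists>g'\<in>S. \<forall>x. (g has_real_derivative g' x) (at x)"
  shows "smooth1 f"
proof -
  have dS: "deriv g \<in> S \<and> (\<forall>x. (g has_real_derivative deriv g x) (at x))" if "g \<in> S" for g
  proof -
    obtain g' where g': "g' \<in> S" "\<And>x. (g has_real_derivative g' x) (at x)"
      using step \<open>g \<in> S\<close> by blast
    then have "deriv g = g'"
      by (intro ext DERIV_imp_deriv)
    with g' show ?thesis by simp
  qed
  have "(deriv ^^ n) f \<in> S" for n
    by (induction n) (use dS \<open>f \<in> S\<close> in auto)
  with dS show ?thesis
    unfolding smooth1_def by simp
qed

lemma smooth1_deriv: "smooth1 f \<Longrightarrow> smooth1 (deriv f)"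
  unfolding smooth1_def by (metis funpow_Suc_right o_apply)

lemma smooth1_funpow_deriv: "smooth1 f \<Longrightarrow> smooth1 ((deriv ^^ n) f)"
  by (induction n) (auto intro: smooth1_deriv)

lemma smooth1_has_deriv: "smooth1 f \<Longrightarrow> (f has_real_derivative deriv f x) (at x)"
  unfolding smooth1_def by (metis funpow_0 funpow_simps_right(2) o_apply funpow.simps(2))

lemma smooth1_continuous: "smooth1 f \<Longrightarrow> continuous_on A f"
  by (meson DERIV_isCont continuous_at_imp_continuous_on smooth1_has_deriv)

lemma smooth1_add:
  assumes "smooth1 f" "smooth1 g" shows "smooth1 (\<lambda>x. f x + g x)"
proof (rule smooth1_coinduct[where S = "{\<lambda>x. f x + g x | f g. smooth1 f \<and> smooth1 g}"])
  fix u assume "u \<in> {\<lambda>x. f x + g x | f g. smooth1 f \<and> smooth1 g}"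
  then obtain f g where u: "u = (\<lambda>x. f x + g x)" and fg: "smooth1 f" "smooth1 g" by blast
  have "(u has_real_derivative deriv f x + deriv g x) (at x)" for x
    unfolding u by (intro derivative_intros smooth1_has_deriv fg)
  moreover have "(\<lambda>x. deriv f x + deriv g x) \<in> {\<lambda>x. f x + g x | f g. smooth1 f \<and> smooth1 g}"
    using fg smooth1_deriv by blast
  ultimately show "\<exists>u'\<in>{\<lambda>x. f x + g x | f g. smooth1 f \<and> smooth1 g}. \<forall>x. (u has_real_derivative u' x) (at x)"
    by (intro bexI allI)
qed (use assms in blast)

lemma smooth1_const: "smooth1 (\<lambda>x. c)"
  by (rule smooth1_coinduct[where S = "range (\<lambda>c x. c)"]) (auto intro: exI[of _ 0])

lemma smooth1_affine:
  assumes "smooth1 f" shows "smooth1 (\<lambda>x. c * f (a * x + b))"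
proof (rule smooth1_coinduct[where S = "{\<lambda>x. c * f (a * x + b) | c f. smooth1 f}"])
  fix g assume "g \<in> {\<lambda>x. c * f (a * x + b) | c f. smooth1 f}"
  then obtain c f where g: "g = (\<lambda>x. c * f (a * x + b))" and f: "smooth1 f" by blast
  have "(g has_real_derivative (c * a) * deriv f (a * x + b)) (at x)" for x
    unfolding g by (rule derivative_eq_intros DERIV_chain2[OF smooth1_has_deriv[OF f]] refl)+ simp
  moreover have "(\<lambda>x. (c * a) * deriv f (a * x + b)) \<in> {\<lambda>x. c * f (a * x + b) | c f. smooth1 f}"
    using smooth1_deriv[OF f] by blast
  ultimately show "\<exists>g'\<in>{\<lambda>x. c * f (a * x + b) | c f. smooth1 f}. \<forall>x. (g has_real_derivative g' x) (at x)"
    by (intro bexI allI)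
qed (use assms in blast)

text \<open>By Leibniz's rule products alone are not stable under differentiation, but finite sums
  of products are; this is the invariant family for \<open>smooth1_mult\<close>.\<close>

inductive_set prod_span :: "(real \<Rightarrow> real) set" where
  prod: "smooth1 f \<Longrightarrow> smooth1 g \<Longrightarrow> (\<lambda>x. f x * g x) \<in> prod_span"
| add: "u \<in> prod_span \<Longrightarrow> v \<in> prod_span \<Longrightarrow> (\<lambda>x. u x + v x) \<in> prod_span"

lemma smooth1_mult:
  assumes "smooth1 f" "smooth1 g" shows "smooth1 (\<lambda>x. f x * g x)"
proof (rule smooth1_coinduct[where S = prod_span])
  fix u assume "u \<in> prod_span"
  then show "\<exists>u'\<in>prod_span. \<forall>x. (u has_real_derivative u' x) (at x)"
  proof induction
    case (prod f g)
    have "(\<lambda>x. deriv f x * g x + f x * deriv g x) \<in> prod_span"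
      by (intro prod_span.intros prod smooth1_deriv)
    moreover have "((\<lambda>x. f x * g x) has_real_derivative deriv f x * g x + f x * deriv g x) (at x)" for x
      by (auto intro!: derivative_eq_intros smooth1_has_deriv prod)
    ultimately show ?case by (intro bexI allI)
  next
    case (add u v)
    then obtain u' v' where "u' \<in> prod_span" "v' \<in> prod_span"
      "\<And>x. (u has_real_derivative u' x) (at x)" "\<And>x. (v has_real_derivative v' x) (at x)" by blast
    then show ?case
      by (intro bexI[of _ "\<lambda>x. u' x + v' x"]) (auto intro!: derivative_eq_intros prod_span.add)
  qed
qed (simp add: prod_span.prod assms)

section \<open>Functions vanishing outside a closed or compact set\<close>

lemma funpow_deriv_eq_0_outside:
  assumes "closed A" "\<And>x. x \<notin> A \<Longrightarrow> f x = 0" "x \<notin> A"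
  shows "(deriv ^^ n) f x = (0::real)"
  using \<open>x \<notin> A\<close>
proof (induction n arbitrary: x)
  case (Suc n)
  have "((deriv ^^ n) f has_field_derivative 0) (at x)"
    by (rule has_field_derivative_transform_within_open[of "\<lambda>_. 0" _ _ "- A"])
      (use Suc assms in \<open>auto simp: open_Compl\<close>)
  then show ?case by (simp add: DERIV_imp_deriv)
qed (use assms in auto)

lemma deriv_eq_0_outside:
  assumes "closed A" "\<And>x. x \<notin> A \<Longrightarrow> f x = 0" "x \<notin> A"
  shows "deriv f x = (0::real)"
  using funpow_deriv_eq_0_outside[OF assms, where n = 1] by simp

lemma bounded_if_compact_support:
  fixes f :: "'a::topological_space \<Rightarrow> real"
  assumes "continuous_on UNIV f" "compact A" "\<And>x. x \<notin> A \<Longrightarrow> f x = 0"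
  obtains B where "B > 0" "\<And>x. \<bar>f x\<bar> \<le> B"
proof -
  have "compact (f ` A)"
    using assms by (meson compact_continuous_image continuous_on_subset subset_UNIV)
  then obtain B where B: "B > 0" "\<And>y. y \<in> f ` A \<Longrightarrow> norm y \<le> B"
    using compact_imp_bounded bounded_pos by metis
  have "\<bar>f x\<bar> \<le> B" for x
    using B assms(3)[of x] by (cases "x \<in> A") auto
  with B(1) that show ?thesis by blast
qed

section \<open>A smooth step function\<close>

lemma smooth1_exp_inverse: "smooth1 (\<lambda>t. if t > 0 then exp (- 1 / t) else 0)"
proof -
  \<comment> \<open>The functions \<open>p(1/t) exp(-1/t)\<close>, extended by 0, form the invariant
    family. With \<open>s = 1/t\<close>, differentiation replaces \<open>p\<close> by
    \<open>s\<^sup>2 (p - p')\<close>, which is the polynomial in \<open>step\<close>.\<close>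
  define E where "E p = (\<lambda>t::real. if t > 0 then poly p (1 / t) * exp (- 1 / t) else 0)" for p :: "real poly"
  have lim: "((\<lambda>s. poly p s / exp s) \<longlongrightarrow> 0) at_top" for p :: "real poly"
  proof -
    have "((\<lambda>s. \<Sum>i\<le>degree p. coeff p i * (s ^ i / exp s)) \<longlongrightarrow> (\<Sum>i\<le>degree p. coeff p i * 0)) at_top"
      by (intro tendsto_sum tendsto_mult tendsto_const tendsto_power_div_exp_0)
    then show ?thesis by (simp add: poly_altdef sum_divide_distrib)
  qed
  have lim0: "(E p \<longlongrightarrow> 0) (at 0)" for p
  proof -
    have "((\<lambda>t. poly p (inverse t) / exp (inverse t)) \<longlongrightarrow> 0) (at_right 0)"
      by (rule filterlim_compose[OF lim filterlim_inverse_at_top_right])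
    then have "(E p \<longlongrightarrow> 0) (at_right 0)"
      by (rule Lim_transform_eventually)
        (auto simp: eventually_at_filter E_def exp_minus field_simps)
    moreover have "(E p \<longlongrightarrow> 0) (at_left 0)"
      by (rule Lim_transform_eventually[OF tendsto_const]) (auto simp: eventually_at_filter E_def)
    ultimately show ?thesis using filterlim_split_at by blast
  qed
  have step: "(E p has_real_derivative E ([:0, 0, 1:] * (p - pderiv p)) t) (at t)" for p t
  proof -
    consider "t > 0" | "t < 0" | "t = 0" by linarith
    then show ?thesis
    proof cases
      case 1
      have "((\<lambda>t. poly p (1 / t) * exp (- 1 / t)) has_real_derivative
          poly ([:0, 0, 1:] * (p - pderiv p)) (1 / t) * exp (- 1 / t)) (at t)"
        using 1 by (auto intro!: derivative_eq_intros DERIV_chain2[OF poly_DERIV] simp: field_simps power2_eq_square)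
      then have "(E p has_real_derivative
          poly ([:0, 0, 1:] * (p - pderiv p)) (1 / t) * exp (- 1 / t)) (at t)"
        by (rule has_field_derivative_transform_within_open[of _ _ _ "{0<..}"]) (use 1 in \<open>auto simp: E_def\<close>)
      with 1 show ?thesis by (simp add: E_def)
    next
      case 2
      have "(E p has_real_derivative 0) (at t)"
        by (rule has_field_derivative_transform_within_open[of "\<lambda>_. 0" _ _ "{..<0}"]) (use 2 in \<open>auto simp: E_def\<close>)
      with 2 show ?thesis by (simp add: E_def)
    next
      case 3
      \<comment> \<open>Division by \<open>h\<close> multiplies \<open>p(1/h)\<close> by
        \<open>1/h\<close>. The difference quotient at 0 is therefore again a member of the family,
        and \<open>lim0\<close> applies.\<close>
      have "((\<lambda>h. E p h / h) \<longlongrightarrow> 0) (at 0)"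
        by (rule Lim_transform_eventually[OF lim0[of "[:0, 1:] * p"]])
          (auto simp: E_def eventually_at_filter field_simps)
      then show ?thesis
        unfolding DERIV_def 3 by (simp add: E_def)
    qed
  qed
  have "smooth1 (E 1)"
    by (rule smooth1_coinduct[where S = "range E"]) (use step in auto)
  then show ?thesis by (simp add: E_def cong: if_cong)
qed

text \<open>The step is the normalised antiderivative of the bump \<open>r\<close>, which is
  positive exactly on the open interval from 1 to 2. Both functions are used later: \<open>h\<close>
  cuts off neighbourhoods of lines, and \<open>deriv h\<close> is a kernel of mass 1 supported away
  from 0.\<close>

lemma smooth1_step_exists:
  obtains h where "smooth1 h" "\<And>t. t \<le> 1 \<Longrightarrow> h t = 0" "\<And>t. t \<ge> 2 \<Longrightarrow> h t = 1" "\<And>t. 0 \<le> h t"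
    "\<And>t. h t \<le> 1" "\<And>t. 0 \<le> deriv h t" "\<And>t. t \<notin> {1..2} \<Longrightarrow> deriv h t = 0"
proof -
  define e where "e = (\<lambda>t::real. if t > 0 then exp (- 1 / t) else 0)"
  define r where "r t = e (1 * t + (-1)) * e ((-1) * t + 2)" for t
  have "smooth1 (\<lambda>t. e (a * t + b))" for a b
    using smooth1_affine[OF smooth1_exp_inverse, of 1 a b] by (simp add: e_def)
  then have r: "smooth1 r"
    unfolding r_def[abs_def] by (intro smooth1_mult)
  have r0: "r t \<ge> 0" "t \<notin> {1<..<2} \<Longrightarrow> r t = 0" "t \<in> {1<..<2} \<Longrightarrow> r t > 0" for t
    by (auto simp: r_def e_def)
  obtain F where F: "\<And>x. (F has_vector_derivative r x) (at x)"
    using einterval_antiderivative[of "-\<infinity>" "\<infinity>" r] r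
    by (auto simp: continuous_at_imp_continuous_on) (meson DERIV_isCont smooth1_has_deriv)
  then have F: "(F has_real_derivative r x) (at x)" for x
    by (simp add: has_real_derivative_iff_has_vector_derivative)
  have mono: "F a \<le> F b" if "a \<le> b" for a b
    by (rule DERIV_nonneg_imp_nondecreasing[OF that]) (use F r0 in blast)
  have F1: "F t = F 1" if "t \<le> 1" for t
  proof (cases "t = 1")
    case False
    then obtain z where "t < z" "z < 1" "F 1 - F t = (1 - t) * r z"
      using MVT2[of t 1 F r] F \<open>t \<le> 1\<close> by auto
    then show ?thesis using r0(2)[of z] by simp
  qed simp
  have F2: "F t = F 2" if "t \<ge> 2" for t
  proof (cases "t = 2")
    case False
    then obtain z where "2 < z" "z < t" "F t - F 2 = (t - 2) * r z"
      using MVT2[of 2 t F r] F \<open>t \<ge> 2\<close> by auto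
    then show ?thesis using r0(2)[of z] by simp
  qed simp
  obtain z where "1 < z" "z < 2" "F 2 - F 1 = (2 - 1) * r z"
    using MVT2[of 1 2 F r] F by auto
  then have pos: "F 2 - F 1 > 0" using r0(3)[of z] by simp
  define h where "h t = (F t - F 1) / (F 2 - F 1)" for t
  have dh: "(h has_real_derivative r t / (F 2 - F 1)) (at t)" for t
    unfolding h_def using F pos by (auto intro!: derivative_eq_intros)
  have deq: "deriv h = (\<lambda>t. r t / (F 2 - F 1))"
    using dh by (intro ext DERIV_imp_deriv)
  have "smooth1 (\<lambda>t. 1 / (F 2 - F 1) * r (1 * t + 0))"
    by (intro smooth1_affine r)
  then have sd: "smooth1 (deriv h)" by (simp add: deq)
  have "smooth1 h"
    by (rule smooth1_coinduct[where S = "insert h (Collect smooth1)"])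
      (use sd dh in \<open>auto simp: deq intro: smooth1_deriv smooth1_has_deriv\<close>)
  moreover have "h t = 0" if "t \<le> 1" for t using F1[OF that] by (simp add: h_def)
  moreover have "h t = 1" if "t \<ge> 2" for t using F2[OF that] pos by (simp add: h_def)
  moreover have "h t \<ge> 0" for t
    using mono[of 1 t] F1[of t] pos by (cases "t \<le> 1") (auto simp: h_def)
  moreover have "h t \<le> 1" for t
    using mono[of t 2] F2[of t] pos by (cases "t \<le> 2") (auto simp: h_def)
  moreover have "deriv h t \<ge> 0" for t using pos r0(1)[of t] by (simp add: deq)
  moreover have "deriv h t = 0" if "t \<notin> {1..2}" for t using that r0(2)[of t] by (auto simp: deq)
  ultimately show thesis using that by blast
qed

subsection \<open>Mollification in the square mean\<close>

definition conv :: "('a::euclidean_space \<Rightarrow> real) \<Rightarrow> ('a \<Rightarrow> real) \<Rightarrow> 'a \<Rightarrow> real" where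
  "conv K V p = (\<integral>q. K (p - q) * V q \<partial>lborel)"

lemma lborel_distr_reflect: "distr lborel borel (\<lambda>x. t - x) = (lborel :: 'a::euclidean_space measure)"
  using lborel_affine[of "-1" t] by (simp add: density_1)

lemma nn_integral_lborel_translate:
  fixes f :: "'a::euclidean_space \<Rightarrow> ennreal"
  assumes [measurable]: "f \<in> borel_measurable borel"
  shows "(\<integral>\<^sup>+x. f (x - t) \<partial>lborel) = (\<integral>\<^sup>+x. f x \<partial>lborel)"
  by (subst (2) lborel_distr_plus[of "- t", symmetric]) (simp add: nn_integral_distr)

lemma has_bochner_integral_lborel_reflect:
  fixes f :: "'a::euclidean_space \<Rightarrow> real"
  assumes "has_bochner_integral lborel f x"
  shows "has_bochner_integral lborel (\<lambda>q. f (t - q)) x"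
proof -
  have [measurable]: "f \<in> borel_measurable borel" using assms by (auto simp: has_bochner_integral_iff)
  have "integrable lborel (\<lambda>q. f (t - q))"
    using integrable_distr_eq[of "\<lambda>q. t - q" lborel borel f] assms
    by (simp add: lborel_distr_reflect has_bochner_integral_iff)
  moreover have "(\<integral>q. f (t - q) \<partial>lborel) = x"
    using integral_distr[of "\<lambda>q. t - q" lborel borel f] assms
    by (simp add: lborel_distr_reflect has_bochner_integral_iff)
  ultimately show ?thesis by (simp add: has_bochner_integral_iff)
qed

lemma integrable_mult_bounded_continuous:
  fixes w V :: "'a::euclidean_space \<Rightarrow> real"
  assumes "continuous_on UNIV w" "\<And>x. \<bar>w x\<bar> \<le> B" "integrable lborel V"
  shows "integrable lborel (\<lambda>x. w x * V x)"
proof (rule Bochner_Integration.integrable_bound[of _ "\<lambda>x. B * V x"])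
  have [measurable]: "w \<in> borel_measurable borel" "V \<in> borel_measurable borel"
    using assms borel_measurable_continuous_onI by auto
  show "(\<lambda>x. w x * V x) \<in> borel_measurable lborel" by measurable
  show "AE x in lborel. norm (w x * V x) \<le> norm (B * V x)"
    by (intro AE_I2) (auto simp: abs_mult intro!: mult_right_mono order_trans[OF assms(2) abs_ge_self])
qed (use assms in auto)

text \<open>The support may lie anywhere in the ball, in particular away from the origin inside one
  quadrant, as it does for the kernels of \<open>scalar_approximation\<close>.\<close>

locale mollifier =
  fixes K :: "'a::euclidean_space \<Rightarrow> real" and r :: real
  assumes cont: "continuous_on UNIV K"
    and nonneg: "0 \<le> K z"
    and support: "r \<le> norm z \<Longrightarrow> K z = 0"
    and integral_1: "has_bochner_integral lborel K 1"
begin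

lemma bounded: obtains B where "\<And>x. \<bar>K x\<bar> \<le> B"
proof -
  have "K x = 0" if "x \<notin> cball 0 r" for x
    using that by (intro support) simp
  then obtain B where "\<And>x. \<bar>K x\<bar> \<le> B"
    by (rule bounded_if_compact_support[OF cont compact_cball[of 0 r]]) blast+
  then show thesis by (rule that)
qed

lemma measurable[measurable]: "K \<in> borel_measurable borel"
  using cont by (rule borel_measurable_continuous_onI)

lemma integrable_conv:
  assumes "integrable lborel V" shows "integrable lborel (\<lambda>q. K (p - q) * V q)"
proof -
  obtain B where "\<And>x. \<bar>K x\<bar> \<le> B" by (rule bounded) blast
  then show ?thesis
    by (intro integrable_mult_bounded_continuous[of _ B] assms)
      (auto intro!: continuous_on_compose2[OF cont] continuous_intros)
qed

lemma conv_square_le: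
  assumes V: "integrable lborel V" and V2: "integrable lborel (\<lambda>x. (V x)\<^sup>2)"
  shows "(conv K V p)\<^sup>2 \<le> (\<integral>q. K (p - q) * (V q)\<^sup>2 \<partial>lborel)"
proof -
  define m where "m = conv K V p"
  have one: "has_bochner_integral lborel (\<lambda>q. K (p - q)) 1"
    by (rule has_bochner_integral_lborel_reflect[OF integral_1])
  note int = integrable_conv[OF V, of p] integrable_conv[OF V2, of p]
  \<comment> \<open>Under the probability density \<open>K (p - _)\<close>, the variance of \<open>V\<close> is nonnegative.\<close>
  have "0 \<le> (\<integral>q. K (p - q) * (V q - m)\<^sup>2 \<partial>lborel)"
    by (intro Bochner_Integration.integral_nonneg) (simp add: nonneg)
  also have "\<dots> = (\<integral>q. K (p - q) * (V q)\<^sup>2 - 2 * m * (K (p - q) * V q) + m\<^sup>2 * K (p - q) \<partial>lborel)"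
    by (intro Bochner_Integration.integral_cong) (auto simp: power2_eq_square algebra_simps)
  also have "\<dots> = (\<integral>q. K (p - q) * (V q)\<^sup>2 \<partial>lborel) - 2 * m * m + m\<^sup>2 * 1"
    using int one by (simp add: m_def conv_def has_bochner_integral_iff)
  finally show ?thesis by (simp add: m_def power2_eq_square)
qed

lemma conv_measurable [measurable]:
  assumes [measurable]: "V \<in> borel_measurable borel"
  shows "conv K V \<in> borel_measurable borel"
  unfolding conv_def[abs_def] by measurable

text \<open>The pointwise bound \<open>conv_square_le\<close> is integrated over \<open>p\<close>;
  by Tonelli the inner integral is the mass 1 of the kernel. With nonnegative integrals, square
  integrability of the convolution comes out of the same computation.\<close>

lemma young:
  assumes V: "integrable lborel V" and V2: "integrable lborel (\<lambda>x. (V x)\<^sup>2)"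
  shows "integrable lborel (\<lambda>p. (conv K V p)\<^sup>2)"
    and "(\<integral>p. (conv K V p)\<^sup>2 \<partial>lborel) \<le> (\<integral>p. (V p)\<^sup>2 \<partial>lborel)"
proof -
  have [measurable]: "V \<in> borel_measurable borel" using V by auto
  have "(\<integral>\<^sup>+p. ennreal ((conv K V p)\<^sup>2) \<partial>lborel) \<le> (\<integral>\<^sup>+p. \<integral>\<^sup>+q. ennreal (K (p - q) * (V q)\<^sup>2) \<partial>lborel \<partial>lborel)"
  proof (rule nn_integral_mono)
    fix p
    have "(\<integral>\<^sup>+q. ennreal (K (p - q) * (V q)\<^sup>2) \<partial>lborel) = ennreal (\<integral>q. K (p - q) * (V q)\<^sup>2 \<partial>lborel)"
      using integrable_conv[OF V2] nonneg by (intro nn_integral_eq_integral) auto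
    with conv_square_le[OF V V2]
    show "ennreal ((conv K V p)\<^sup>2) \<le> (\<integral>\<^sup>+q. ennreal (K (p - q) * (V q)\<^sup>2) \<partial>lborel)"
      by (simp add: ennreal_leI)
  qed
  also have "\<dots> = (\<integral>\<^sup>+q. \<integral>\<^sup>+p. ennreal (K (p - q) * (V q)\<^sup>2) \<partial>lborel \<partial>lborel)"
    by (rule lborel_pair.Fubini'[symmetric]) measurable
  also have "\<dots> = (\<integral>\<^sup>+q. (\<integral>\<^sup>+p. ennreal (K (p - q)) \<partial>lborel) * ennreal ((V q)\<^sup>2) \<partial>lborel)"
    by (simp add: ennreal_mult nonneg nn_integral_multc)
  also have "\<dots> = (\<integral>\<^sup>+q. (\<integral>\<^sup>+p. ennreal (K p) \<partial>lborel) * ennreal ((V q)\<^sup>2) \<partial>lborel)"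
    using nn_integral_lborel_translate[of "\<lambda>p. ennreal (K p)"] by simp
  also have "(\<integral>\<^sup>+p. ennreal (K p) \<partial>lborel) = 1"
    using integral_1 nonneg by (subst nn_integral_eq_integral) (auto simp: has_bochner_integral_iff)
  also have "(\<integral>\<^sup>+q. 1 * ennreal ((V q)\<^sup>2) \<partial>lborel) = ennreal (\<integral>q. (V q)\<^sup>2 \<partial>lborel)"
    using V2 by (simp add: nn_integral_eq_integral)
  finally have le: "(\<integral>\<^sup>+p. ennreal ((conv K V p)\<^sup>2) \<partial>lborel) \<le> ennreal (\<integral>q. (V q)\<^sup>2 \<partial>lborel)" .
  show int: "integrable lborel (\<lambda>p. (conv K V p)\<^sup>2)"
    using le by (intro integrableI_nonneg) (auto simp: top_unique le_less_trans[OF le])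
  show "(\<integral>p. (conv K V p)\<^sup>2 \<partial>lborel) \<le> (\<integral>p. (V p)\<^sup>2 \<partial>lborel)"
    using le by (simp add: nn_integral_eq_integral[OF int] ennreal_le_iff)
qed

text \<open>The kernel has mass 1 and sees only \<open>q\<close> with
  \<open>norm (p - q) < r\<close>, so \<open>conv K f p\<close> is a mean of values that lie within
  \<open>d\<close> of \<open>f p\<close>.\<close>

lemma conv_diff_le:
  assumes f: "integrable lborel f" and d: "\<And>x y. norm (x - y) < r \<Longrightarrow> \<bar>f x - f y\<bar> \<le> d"
  shows "\<bar>conv K f p - f p\<bar> \<le> d"
proof -
  have one: "has_bochner_integral lborel (\<lambda>q. K (p - q)) 1"
    by (rule has_bochner_integral_lborel_reflect[OF integral_1])
  have "conv K f p - f p = (\<integral>q. K (p - q) * f q - K (p - q) * f p \<partial>lborel)"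
    using one integrable_conv[OF f, of p] by (simp add: conv_def has_bochner_integral_iff)
  also have "\<bar>\<dots>\<bar> \<le> (\<integral>q. K (p - q) * d \<partial>lborel)"
  proof (rule integral_abs_bound_integral)
    show "\<bar>K (p - q) * f q - K (p - q) * f p\<bar> \<le> K (p - q) * d" for q
    proof (cases "r \<le> norm (p - q)")
      case False
      then have "\<bar>f q - f p\<bar> \<le> d" by (intro d) (simp add: norm_minus_commute)
      then show ?thesis
        using mult_left_mono[OF _ nonneg[of "p - q"], of "\<bar>f q - f p\<bar>" d] nonneg[of "p - q"]
        by (simp flip: right_diff_distrib add: abs_mult)
    qed (simp add: support)
  qed (use one integrable_conv[OF f, of p] in \<open>auto simp: has_bochner_integral_iff\<close>)
  also have "\<dots> = d" using one by (simp add: has_bochner_integral_iff)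
  finally show ?thesis .
qed

end

section \<open>Approximation by continuous functions in the square mean\<close>

lemma integrable_if_square_integrable:
  fixes V :: "'a::euclidean_space \<Rightarrow> real"
  assumes [measurable]: "V \<in> borel_measurable borel" and V2: "integrable lborel (\<lambda>x. (V x)\<^sup>2)"
    and A: "bounded A" "\<And>x. x \<notin> A \<Longrightarrow> V x = 0"
  shows "integrable lborel V"
proof -
  obtain R where R: "A \<subseteq> cball 0 R" using bounded_subset_ballD[OF A(1), of 0] ball_subset_cball by fastforce
  show ?thesis
  proof (rule Bochner_Integration.integrable_bound[of _ "\<lambda>x. indicator (cball 0 R) x + (V x)\<^sup>2"])
    show "integrable lborel (\<lambda>x. indicator (cball 0 R) x + (V x)\<^sup>2)"
      by (intro Bochner_Integration.integrable_add V2 integrable_real_indicator)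
        (auto intro!: emeasure_bounded_finite[unfolded infinity_ennreal_def])
    \<comment> \<open>The square alone does not dominate \<open>\<bar>t\<bar>\<close> near 0. The
      added constant is integrable because it is confined to a ball.\<close>
    have "\<bar>t\<bar> \<le> 1 + t\<^sup>2" for t :: real
      using zero_le_power2[of "\<bar>t\<bar> - 1"] abs_ge_zero[of t] unfolding power2_diff power2_abs power_one by linarith
    then show "AE x in lborel. norm (V x) \<le> norm (indicator (cball 0 R) x + (V x)\<^sup>2)"
      using A(2) R by (intro AE_I2) (force simp: indicator_def)
  qed simp
qed

text \<open>Measurability provides continuous \<open>g n\<close> converging to \<open>V\<close>
  almost everywhere, but without domination. Hence the values are first truncated at level
  \<open>k\<close>, which costs little by dominated convergence; then \<open>g n\<close> is
  truncated at the same level and multiplied by \<open>c\<close>, which is 1 on \<open>A\<close> and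
  0 outside a larger ball. All differences are now bounded on one ball, and dominated convergence
  applies again.\<close>

lemma L2_approx_continuous:
  fixes V :: "'a::euclidean_space \<Rightarrow> real"
  assumes [measurable]: "V \<in> borel_measurable borel" and V2: "integrable lborel (\<lambda>x. (V x)\<^sup>2)"
    and A: "bounded A" "\<And>x. x \<notin> A \<Longrightarrow> V x = 0" and "e > 0"
  obtains f C where "continuous_on UNIV f" "compact C" "\<And>x. x \<notin> C \<Longrightarrow> f x = 0"
    "integrable lborel (\<lambda>x. (V x - f x)\<^sup>2)" "(\<integral>x. (V x - f x)\<^sup>2 \<partial>lborel) < e"
proof -
  obtain R where R: "A \<subseteq> cball 0 R" using bounded_subset_ballD[OF A(1), of 0] ball_subset_cball by fastforce
  define c where "c x = max 0 (min 1 (R + 1 - norm x))" for x :: 'a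
  define clip where "clip k x = max (- real k) (min (real k) x)" for k :: nat and x :: real
  have clip: "\<bar>clip k x\<bar> \<le> k" "(x - clip k x)\<^sup>2 \<le> x\<^sup>2" for k x
    by (auto simp: clip_def max_def min_def abs_le_square_iff[symmetric])
  have [measurable]: "clip k \<in> borel_measurable borel" "c \<in> borel_measurable borel" for k
    unfolding clip_def[abs_def] c_def[abs_def] by measurable
  have "(\<lambda>k. \<integral>x. (V x - clip k (V x))\<^sup>2 \<partial>lborel) \<longlonglongrightarrow> integral\<^sup>L (lborel :: 'a measure) (\<lambda>_. 0)"
  proof (rule integral_dominated_convergence[where w = "\<lambda>x. (V x)\<^sup>2"])
    show "AE x in lborel. (\<lambda>k. (V x - clip k (V x))\<^sup>2) \<longlonglongrightarrow> 0"
    proof (intro AE_I2 tendsto_eventually)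
      fix x
      obtain n where "\<bar>V x\<bar> \<le> real n" using real_arch_simple by blast
      then show "\<forall>\<^sub>F k in sequentially. (V x - clip k (V x))\<^sup>2 = 0"
        by (intro eventually_sequentiallyI[of n]) (auto simp: clip_def)
    qed
  qed (use V2 clip in auto)
  then have "\<forall>\<^sub>F k in sequentially. (\<integral>x. (V x - clip k (V x))\<^sup>2 \<partial>lborel) < e / 4"
    using \<open>e > 0\<close> by (intro order_tendstoD) auto
  then obtain k where k: "(\<integral>x. (V x - clip k (V x))\<^sup>2 \<partial>lborel) < e / 4"
    using eventually_happens'[OF sequentially_bot] by blast
  have intk: "integrable lborel (\<lambda>x. (V x - clip k (V x))\<^sup>2)"
    by (rule Bochner_Integration.integrable_bound[OF V2]) (use clip in auto)
  have "V measurable_on UNIV"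
    by (rule lebesgue_measurable_imp_measurable_on_real) (auto intro: measurable_completion)
  then obtain N g where N: "negligible N" and g: "\<And>n. continuous_on UNIV (g n)"
    and lim: "\<And>x. x \<notin> N \<Longrightarrow> (\<lambda>n. g n x) \<longlonglongrightarrow> V x"
    unfolding measurable_on_def by auto
  have AE_N: "AE x in lborel. x \<notin> N"
    using N by (metis negligible_iff_null_sets AE_not_in AE_completion_iff)
  define F where "F n x = c x * clip k (g n x)" for n x
  have contF: "continuous_on UNIV (F n)" for n
    unfolding F_def c_def clip_def using g by (intro continuous_intros) auto
  then have [measurable]: "F n \<in> borel_measurable borel" for n
    by (rule borel_measurable_continuous_onI)
  have Fout: "F n x = 0" if "x \<notin> cball 0 (R + 1)" for n x
    using that by (auto simp: F_def c_def)
  have Vk: "clip k (V x) = c x * clip k (V x)" for x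
    using A(2)[of x] R by (cases "x \<in> A") (auto simp: c_def clip_def)
  have bound: "(clip k (V x) - F n x)\<^sup>2 \<le> (2 * real k)\<^sup>2 * indicator (cball 0 (R + 1)) x" for n x
  proof (cases "x \<in> cball 0 (R + 1)")
    case True
    have c01: "0 \<le> c x" "c x \<le> 1" by (auto simp: c_def)
    have "\<bar>F n x\<bar> \<le> 1 * real k"
      unfolding F_def abs_mult using clip c01 by (intro mult_mono) auto
    then have "\<bar>clip k (V x) - F n x\<bar> \<le> \<bar>2 * real k\<bar>" using clip(1)[of k "V x"] by linarith
    with True show ?thesis by (simp only: abs_le_square_iff) simp
  next
    case False
    then have "x \<notin> cball 0 R" by simp
    then have "V x = 0" using A(2)[of x] R by blast
    with False Fout show ?thesis by (auto simp: clip_def)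
  qed
  have intb: "integrable lborel (\<lambda>x::'a. (2 * real k)\<^sup>2 * indicator (cball 0 (R + 1)) x)"
    by (intro integrable_mult_right integrable_real_indicator) (auto intro!: emeasure_bounded_finite[unfolded infinity_ennreal_def])
  have "(\<lambda>n. \<integral>x. (clip k (V x) - F n x)\<^sup>2 \<partial>lborel) \<longlonglongrightarrow> integral\<^sup>L (lborel :: 'a measure) (\<lambda>_. 0)"
  proof (rule integral_dominated_convergence[OF _ _ intb])
    show "AE x in lborel. (\<lambda>n. (clip k (V x) - F n x)\<^sup>2) \<longlonglongrightarrow> 0"
      using AE_N
    proof eventually_elim
      case (elim x)
      have "(\<lambda>n. (clip k (V x) - F n x)\<^sup>2) \<longlonglongrightarrow> (clip k (V x) - c x * clip k (V x))\<^sup>2"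
        unfolding F_def clip_def using lim[OF elim] by (intro tendsto_intros)
      then show ?case using Vk[of x] by simp
    qed
  qed (use bound in auto)
  then have "\<forall>\<^sub>F n in sequentially. (\<integral>x. (clip k (V x) - F n x)\<^sup>2 \<partial>lborel) < e / 4"
    using \<open>e > 0\<close> by (intro order_tendstoD) auto
  then obtain n where n: "(\<integral>x. (clip k (V x) - F n x)\<^sup>2 \<partial>lborel) < e / 4"
    using eventually_happens'[OF sequentially_bot] by blast
  have intF: "integrable lborel (\<lambda>x. (clip k (V x) - F n x)\<^sup>2)"
    by (rule Bochner_Integration.integrable_bound[OF intb]) (use bound in auto)
  \<comment> \<open>Each of the two errors enters with a factor 2, which is why each was made less
    than \<open>e / 4\<close>.\<close>
  have le: "(V x - F n x)\<^sup>2 \<le> 2 * (V x - clip k (V x))\<^sup>2 + 2 * (clip k (V x) - F n x)\<^sup>2" for x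
    using zero_le_power2[of "(V x - clip k (V x)) - (clip k (V x) - F n x)"]
    by (simp add: power2_eq_square algebra_simps)
  have intVF: "integrable lborel (\<lambda>x. (V x - F n x)\<^sup>2)"
    by (rule Bochner_Integration.integrable_bound[of _ "\<lambda>x. 2 * (V x - clip k (V x))\<^sup>2 + 2 * (clip k (V x) - F n x)\<^sup>2"])
      (use le intk intF in auto)
  have "(\<integral>x. (V x - F n x)\<^sup>2 \<partial>lborel) \<le> (\<integral>x. 2 * (V x - clip k (V x))\<^sup>2 + 2 * (clip k (V x) - F n x)\<^sup>2 \<partial>lborel)"
    by (intro integral_mono) (use le intk intF intVF in auto)
  also have "\<dots> < e" using k n intk intF by simp
  finally show thesis
    using that[of "F n" "cball 0 (R + 1)"] contF Fout intVF by auto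
qed

text \<open>\<open>V\<close> is compared with a compactly supported continuous \<open>f\<close>.
  Convolution does not increase the square norm of \<open>V - f\<close>, by \<open>young\<close>,
  for every kernel alike; for \<open>f\<close> itself uniform continuity gives a pointwise bound,
  which is integrated over the set \<open>S\<close> of finite measure. So \<open>d\<close> depends
  on \<open>V\<close>, \<open>S\<close> and \<open>e\<close> but not on the kernel.\<close>

lemma mollify_L2_tendsto:
  fixes V :: "'a::euclidean_space \<Rightarrow> real"
  assumes [measurable]: "V \<in> borel_measurable borel" and V2: "integrable lborel (\<lambda>x. (V x)\<^sup>2)"
    and A: "bounded A" "\<And>x. x \<notin> A \<Longrightarrow> V x = 0"
    and [measurable]: "S \<in> sets borel" and S: "emeasure lborel S < \<infinity>" and "e > 0"
  obtains d where "d > 0" "\<And>K. mollifier K d \<Longrightarrow>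
    set_integrable lborel S (\<lambda>p. (V p - conv K V p)\<^sup>2) \<and> (LINT p:S|lborel. (V p - conv K V p)\<^sup>2) < e"
proof -
  \<comment> \<open>The square of a sum of three terms is at most three times the sum of the
    squares. The terms \<open>D\<close> and \<open>conv K D\<close> contribute less than
    \<open>6 * (e / 9)\<close> in all, and \<open>m\<close> is chosen so that the third contributes
    at most \<open>e / 3\<close>; the 1 in its denominator covers an \<open>S\<close> of measure
    0.\<close>
  obtain f C where f: "continuous_on UNIV f" "compact C" "\<And>x. x \<notin> C \<Longrightarrow> f x = 0"
    and intVf: "integrable lborel (\<lambda>x. (V x - f x)\<^sup>2)" and small: "(\<integral>x. (V x - f x)\<^sup>2 \<partial>lborel) < e / 9"
    using L2_approx_continuous[OF assms(1-4), of "e / 9"] \<open>e > 0\<close> by auto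
  have V: "integrable lborel V" by (rule integrable_if_square_integrable) fact+
  have fi: "integrable lborel f"
  proof -
    have "integrable lborel (\<lambda>x. indicator C x *\<^sub>R f x)"
      using f by (intro borel_integrable_compact) (auto intro: continuous_on_subset)
    moreover have "(\<lambda>x. indicator C x *\<^sub>R f x) = f" using f(3) by (auto split: split_indicator)
    ultimately show ?thesis by simp
  qed
  define m where "m = sqrt (e / (9 * (measure lborel S + 1)))"
  have "m > 0" using \<open>e > 0\<close> by (auto simp: m_def intro!: divide_pos_pos add_nonneg_pos)
  have m2: "m\<^sup>2 = e / (9 * (measure lborel S + 1))"
    using \<open>e > 0\<close> by (simp add: m_def)
  obtain d where "d > 0" and d: "\<And>x y. dist x y < d \<Longrightarrow> dist (f x) (f y) < m"
  proof -
    obtain b where b: "\<And>x. x \<in> C \<Longrightarrow> norm x \<le> b"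
      using f(2) compact_imp_bounded bounded_pos by metis
    have "uniformly_continuous_on (cball 0 (b + 1)) f"
      by (intro compact_uniformly_continuous continuous_on_subset[OF f(1)]) auto
    then obtain d where d: "d > 0" and
      uc: "\<And>x y. x \<in> cball 0 (b + 1) \<Longrightarrow> y \<in> cball 0 (b + 1) \<Longrightarrow> dist y x < d \<Longrightarrow> dist (f y) (f x) < m"
      using \<open>m > 0\<close> unfolding uniformly_continuous_on_def by metis
    \<comment> \<open>Uniform continuity is known only on a ball. If one of two points at distance
      below 1 lies in \<open>C\<close>, both lie in that ball; if neither does, both values are
      0.\<close>
    have "dist (f x) (f y) < m" if "dist x y < min d 1" for x y
    proof (cases "x \<in> C \<or> y \<in> C")
      case True
      have "norm x \<le> norm y + dist x y" "norm y \<le> norm x + dist x y"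
        using norm_triangle_sub[of x y] norm_triangle_sub[of y x] by (auto simp: dist_norm norm_minus_commute)
      with True b that have "x \<in> cball 0 (b + 1)" "y \<in> cball 0 (b + 1)" by fastforce+
      with uc that show ?thesis by simp
    qed (use f(3) \<open>m > 0\<close> in auto)
    with d show thesis by (intro that[of "min d 1"]) auto
  qed
  show thesis
  proof (rule that[OF \<open>d > 0\<close>])
    fix K :: "'a \<Rightarrow> real" assume "mollifier K d"
    then interpret mollifier K d .
    have [measurable]: "f \<in> borel_measurable borel" using fi by auto
    define D where "D x = V x - f x" for x
    have D: "integrable lborel D" "integrable lborel (\<lambda>x. (D x)\<^sup>2)"
      using V fi intVf by (auto simp: D_def[abs_def])
    have split: "conv K V p = conv K D p + conv K f p" for p
      using integrable_conv[OF V, of p] integrable_conv[OF fi, of p]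
      by (simp add: conv_def D_def right_diff_distrib)
    have cf: "\<bar>conv K f p - f p\<bar> \<le> m" for p
      using d by (intro conv_diff_le[OF fi]) (fastforce simp: dist_norm)
    define W where "W p = 3 * (D p)\<^sup>2 + 3 * (conv K D p)\<^sup>2 + 3 * m\<^sup>2 * indicator S p" for p
    have W: "integrable lborel W"
      unfolding W_def[abs_def] using D young[OF D] S by (auto intro!: integrable_real_indicator)
    have le: "indicator S p *\<^sub>R (V p - conv K V p)\<^sup>2 \<le> W p" for p
    proof (cases "p \<in> S")
      case True
      have sq3: "(a + b + c)\<^sup>2 \<le> 3 * a\<^sup>2 + 3 * b\<^sup>2 + 3 * c\<^sup>2" for a b c :: real
      proof -
        have "0 \<le> (a - b)\<^sup>2 + (b - c)\<^sup>2 + (a - c)\<^sup>2" by simp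
        then show ?thesis by (simp add: power2_eq_square algebra_simps)
      qed
      have "(V p - conv K V p)\<^sup>2 = (D p + (- conv K D p) + (f p - conv K f p))\<^sup>2"
        by (simp add: split D_def algebra_simps)
      also have "\<dots> \<le> 3 * (D p)\<^sup>2 + 3 * (- conv K D p)\<^sup>2 + 3 * (f p - conv K f p)\<^sup>2"
        by (rule sq3)
      also have "(f p - conv K f p)\<^sup>2 \<le> m\<^sup>2"
        using cf[of p] \<open>m > 0\<close> by (simp add: abs_le_square_iff[symmetric])
      finally show ?thesis using True by (simp add: W_def)
    qed (simp add: W_def)
    have int: "set_integrable lborel S (\<lambda>p. (V p - conv K V p)\<^sup>2)"
      unfolding set_integrable_def by (rule Bochner_Integration.integrable_bound[OF W])
       (use order_trans[OF le abs_ge_self] in auto)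
    have "(LINT p:S|lborel. (V p - conv K V p)\<^sup>2) \<le> integral\<^sup>L lborel W"
      unfolding set_lebesgue_integral_def using int W le
      by (intro integral_mono) (auto simp: set_integrable_def)
    also have "\<dots> = 3 * (\<integral>p. (D p)\<^sup>2 \<partial>lborel) + 3 * (\<integral>p. (conv K D p)\<^sup>2 \<partial>lborel) + 3 * m\<^sup>2 * measure lborel S"
      unfolding W_def[abs_def] using D young[OF D] S by (simp add: integrable_real_indicator)
    also have "\<dots> \<le> 6 * (\<integral>p. (D p)\<^sup>2 \<partial>lborel) + 3 * m\<^sup>2 * measure lborel S"
      using young(2)[OF D] by simp
    also have "\<dots> < 6 * (e / 9) + e / 3"
    proof -
      have "3 * m\<^sup>2 * measure lborel S \<le> e / 3"
        using \<open>e > 0\<close> unfolding m2 by (simp add: divide_simps add_nonneg_pos)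
      then show ?thesis using small by (simp add: D_def)
    qed
    finally show "set_integrable lborel S (\<lambda>p. (V p - conv K V p)\<^sup>2) \<and> (LINT p:S|lborel. (V p - conv K V p)\<^sup>2) < e"
      using int by simp
  qed
qed

subsection \<open>Green's formula for products of functions of one variable\<close>

definition tensor :: "(real \<Rightarrow> real) \<Rightarrow> (real \<Rightarrow> real) \<Rightarrow> real \<times> real \<Rightarrow> real" where
  "tensor f k p = f (fst p) * k (snd p)"

lemma tensor_has_derivative:
  assumes "smooth1 f" "smooth1 k"
  shows "(tensor f k has_derivative (\<lambda>h. fst h * tensor (deriv f) k p + snd h * tensor f (deriv k) p)) (at p)"
proof -
  have D: "((\<lambda>p. g (l p)) has_derivative (\<lambda>h. l h * deriv g (l p))) (at p)"
    if "smooth1 g" "bounded_linear l" for g l and p :: "real \<times> real"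
    using has_derivative_compose[OF bounded_linear_imp_has_derivative[OF that(2)]
        smooth1_has_deriv[OF that(1), unfolded has_field_derivative_def]]
    by (simp add: mult.commute)
  show ?thesis
    unfolding tensor_def[abs_def]
    by (rule has_derivative_eq_rhs[OF has_derivative_mult[OF D D]])
      (use assms in \<open>auto simp: algebra_simps bounded_linear_fst bounded_linear_snd\<close>)
qed

lemma continuous_on_tensor: "smooth1 f \<Longrightarrow> smooth1 k \<Longrightarrow> continuous_on S (tensor f k)"
  by (meson tensor_has_derivative has_derivative_continuous continuous_at_imp_continuous_on)

lemma smooth2_tensor:
  assumes "smooth1 f" "smooth1 k" shows "smooth2 (tensor f k)"
  unfolding smooth2_def
proof (intro exI[of _ "\<lambda>a b. tensor ((deriv ^^ a) f) ((deriv ^^ b) k)"] conjI allI)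
  fix a b p
  show "continuous_on UNIV (tensor ((deriv ^^ a) f) ((deriv ^^ b) k))"
    by (intro continuous_on_tensor smooth1_funpow_deriv assms)
  show "(tensor ((deriv ^^ a) f) ((deriv ^^ b) k) has_derivative
          (\<lambda>h. fst h * tensor ((deriv ^^ Suc a) f) ((deriv ^^ b) k) p +
               snd h * tensor ((deriv ^^ a) f) ((deriv ^^ Suc b) k) p)) (at p)"
    using tensor_has_derivative[OF smooth1_funpow_deriv[OF assms(1), of a] smooth1_funpow_deriv[OF assms(2), of b]]
    by simp
qed simp

lemma dx_eqI:
  assumes "(f has_derivative (\<lambda>h. fst h * a + snd h * b)) (at p)"
  shows "dx f p = a" "dy f p = b"
proof -
  have "((\<lambda>t. f (t, snd p)) has_derivative (\<lambda>h. h * a)) (at (fst p))"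
    using has_derivative_compose[OF has_derivative_Pair[OF has_derivative_ident has_derivative_const], of f _ "fst p" "snd p" UNIV] assms
    by fastforce
  then show "dx f p = a"
    unfolding dx_def by (intro DERIV_imp_deriv) (simp add: has_field_derivative_def mult_commute_abs)
  have "((\<lambda>t. f (fst p, t)) has_derivative (\<lambda>h. h * b)) (at (snd p))"
    using has_derivative_compose[OF has_derivative_Pair[OF has_derivative_const has_derivative_ident], of f _ "fst p" "snd p" UNIV] assms
    by fastforce
  then show "dy f p = b"
    unfolding dy_def by (intro DERIV_imp_deriv) (simp add: has_field_derivative_def mult_commute_abs)
qed

lemma dx_tensor:
  assumes "smooth1 f" "smooth1 k"
  shows "dx (tensor f k) p = tensor (deriv f) k p" "dy (tensor f k) p = tensor f (deriv k) p"
  using dx_eqI[OF tensor_has_derivative[OF assms]] by auto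

text \<open>The compact set is a parameter and not the exact support: it passes unchanged to all
  derivatives, and disjointness from the sides can be read off from it.\<close>

definition test_fun :: "(real \<Rightarrow> real) \<Rightarrow> real set \<Rightarrow> bool" where
  "test_fun f A \<longleftrightarrow> smooth1 f \<and> compact A \<and> (\<forall>x. x \<notin> A \<longrightarrow> f x = 0)"

lemma test_fun_deriv: "test_fun f A \<Longrightarrow> test_fun (deriv f) A"
  unfolding test_fun_def by (auto intro: smooth1_deriv deriv_eq_0_outside compact_imp_closed)

lemma test_fun_funpow_deriv: "test_fun f A \<Longrightarrow> test_fun ((deriv ^^ n) f) A"
  by (induction n) (auto intro: test_fun_deriv)

lemma test_fun_bounded:
  assumes "test_fun f A" obtains B where "B > 0" "\<And>x. \<bar>f x\<bar> \<le> B"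
  using bounded_if_compact_support[of f A] assms unfolding test_fun_def
  by (metis smooth1_continuous)

lemma tensor_bounded:
  assumes "test_fun f A" "test_fun k B" obtains C where "C > 0" "\<And>p. \<bar>tensor f k p\<bar> \<le> C"
proof -
  obtain C1 C2 where "C1 > 0" "\<And>x. \<bar>f x\<bar> \<le> C1" "C2 > 0" "\<And>x. \<bar>k x\<bar> \<le> C2"
    using test_fun_bounded[OF assms(1)] test_fun_bounded[OF assms(2)] by metis
  then show ?thesis
    by (intro that[of "C1 * C2"]) (auto simp: tensor_def abs_mult intro: mult_mono)
qed

lemma integrable_mult_tensor:
  assumes "test_fun f A" "test_fun k B" "integrable lborel U"
  shows "integrable lborel (\<lambda>p. U p * tensor f k p)"
proof -
  obtain C where "\<And>p. \<bar>tensor f k p\<bar> \<le> C" using tensor_bounded[OF assms(1,2)] by metis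
  then have "integrable lborel (\<lambda>p. tensor f k p * U p)"
    using assms by (intro integrable_mult_bounded_continuous[of _ C] continuous_on_tensor) (auto simp: test_fun_def)
  then show ?thesis by (simp add: mult.commute)
qed

text \<open>With \<open>U\<close>, \<open>G\<close> extended by zero outside the rectangle, this is the boundary term of Green's
  formula for the test function \<open>f(x) k(y)\<close>; such products are the only test functions needed.\<close>

definition green :: "real \<Rightarrow> (real \<times> real \<Rightarrow> real) \<Rightarrow> (real \<times> real \<Rightarrow> real) \<Rightarrow> (real \<Rightarrow> real) \<Rightarrow> (real \<Rightarrow> real) \<Rightarrow> real" where
  "green lam U G f k = (\<integral>p. U p * (lam * tensor (deriv f) k p + tensor f (deriv k) p) + G p * tensor f k p \<partial>lborel)"

lemma green_integrable:
  assumes "test_fun f A" "test_fun k B" "integrable lborel U" "integrable lborel G"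
  shows "integrable lborel (\<lambda>p. U p * (lam * tensor (deriv f) k p + tensor f (deriv k) p) + G p * tensor f k p)"
proof -
  note int = integrable_mult_tensor[OF test_fun_deriv[OF assms(1)] assms(2,3)]
     integrable_mult_tensor[OF assms(1) test_fun_deriv[OF assms(2)] assms(3)]
     integrable_mult_tensor[OF assms(1,2,4)]
  have "integrable lborel (\<lambda>p. lam * (U p * tensor (deriv f) k p) + U p * tensor f (deriv k) p + G p * tensor f k p)"
    using int by auto
  then show ?thesis by (simp add: algebra_simps)
qed

lemma deriv_add_smooth1: "smooth1 f \<Longrightarrow> smooth1 g \<Longrightarrow> deriv (\<lambda>x. f x + g x) x = deriv f x + deriv g x"
  by (intro DERIV_imp_deriv derivative_intros smooth1_has_deriv)

lemma green_add_left:
  assumes "test_fun f A" "test_fun f' A'" "test_fun k B" "integrable lborel U" "integrable lborel G"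
  shows "green lam U G (\<lambda>x. f x + f' x) k = green lam U G f k + green lam U G f' k"
proof -
  have "smooth1 f" "smooth1 f'" using assms by (auto simp: test_fun_def)
  then show ?thesis
    unfolding green_def
    apply (subst Bochner_Integration.integral_add[symmetric])
    apply (rule green_integrable assms)+
    apply (simp add: tensor_def deriv_add_smooth1 algebra_simps)
    done
qed

lemma green_add_right:
  assumes "test_fun f A" "test_fun k B" "test_fun k' B'" "integrable lborel U" "integrable lborel G"
  shows "green lam U G f (\<lambda>x. k x + k' x) = green lam U G f k + green lam U G f k'"
proof -
  have "smooth1 k" "smooth1 k'" using assms by (auto simp: test_fun_def)
  then show ?thesis
    unfolding green_def
    apply (subst Bochner_Integration.integral_add[symmetric])
    apply (rule green_integrable assms)+
    apply (simp add: tensor_def deriv_add_smooth1 algebra_simps)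
    done
qed

lemma test_fun_mult:
  assumes "test_fun f A" "smooth1 g" "closed C" "\<And>x. x \<notin> C \<Longrightarrow> g x = 0"
  shows "test_fun (\<lambda>x. f x * g x) (A \<inter> C)"
  using assms by (auto simp: test_fun_def intro: smooth1_mult compact_Int_closed)

lemma supp_subset: "closed C \<Longrightarrow> (\<And>p. p \<notin> C \<Longrightarrow> \<phi> p = 0) \<Longrightarrow> supp \<phi> \<subseteq> C"
  unfolding supp_def by (intro closure_minimal) auto

lemma trace_zero_green:
  assumes tz: "trace_zero L1 L2 lam u g s" and f: "test_fun f A" and k: "test_fun k B"
    and disj: "(A \<times> B) \<inter> (\<Union>s'\<in>UNIV - {s}. side_set L1 L2 s') = {}"
  shows "green lam (\<lambda>p. indicator (Omega L1 L2) p * u p) (\<lambda>p. indicator (Omega L1 L2) p * g p) f k = 0"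
proof -
  have sm: "smooth1 f" "smooth1 k" using f k by (auto simp: test_fun_def)
  have cp: "compact (A \<times> B)" using f k by (auto simp: test_fun_def intro: compact_Times)
  have sub: "supp (tensor f k) \<subseteq> A \<times> B"
    using f k by (intro supp_subset compact_imp_closed cp) (auto simp: tensor_def test_fun_def)
  then have "compact (supp (tensor f k))"
    using cp by (metis supp_def closed_closure compact_Int_closed inf.absorb2)
  with tz[unfolded trace_zero_def] sub disj smooth2_tensor[OF sm]
  have "(LINT p:Omega L1 L2|lborel. u p * (lam * dx (tensor f k) p + dy (tensor f k) p) + g p * tensor f k p) = 0"
    by blast
  then show ?thesis
    unfolding set_lebesgue_integral_def green_def by (simp add: dx_tensor[OF sm] algebra_simps)
qed

section \<open>The corner common to two adjacent sides\<close>

lemma green_corner_bound: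
  assumes h: "smooth1 h" "\<And>t. 0 \<le> h t" "\<And>t. h t \<le> 1" "\<And>t. t \<ge> 2 \<Longrightarrow> h t = 1"
      "\<And>t. t \<notin> {1..2} \<Longrightarrow> deriv h t = 0"
    and f: "test_fun f A" and \<sigma>: "\<bar>\<sigma>\<bar> = 1"
    and F: "F = (\<lambda>n x. f x * (1 - h (real n * \<sigma> * (x - c))))"
  obtains C where "C > 0" "\<And>n x. 1 \<le> n \<Longrightarrow> \<bar>F n x\<bar> \<le> C"
    "\<And>n x. 1 \<le> n \<Longrightarrow> \<bar>deriv (F n) x\<bar> \<le> C * real n"
    "\<And>n x. 1 \<le> n \<Longrightarrow> \<sigma> * (x - c) > 2 / real n \<Longrightarrow> deriv (F n) x = 0"
proof -
  obtain B where B: "B > 0" "\<And>x. \<bar>f x\<bar> \<le> B" using test_fun_bounded[OF f] by metis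
  obtain B' where B': "B' > 0" "\<And>x. \<bar>deriv f x\<bar> \<le> B'" using test_fun_bounded[OF test_fun_deriv[OF f]] by metis
  have "\<And>x. x \<notin> {1..2} \<Longrightarrow> deriv h x = 0" using h by blast
  then obtain D where D: "D > 0" "\<And>x. \<bar>deriv h x\<bar> \<le> D"
    using bounded_if_compact_support[of "deriv h" "{1..2}"] smooth1_continuous[OF smooth1_deriv[OF h(1)]] by auto
  have deriv: "deriv (\<lambda>x. f x * (1 - h (real n * \<sigma> * (x - c)))) x =
      deriv f x * (1 - h (real n * \<sigma> * (x - c))) - f x * (n * \<sigma> * deriv h (real n * \<sigma> * (x - c)))" for n :: nat and x :: real
    using f h unfolding test_fun_def
    by (intro DERIV_imp_deriv)
      (auto intro!: derivative_eq_intros smooth1_has_deriv DERIV_chain2[OF smooth1_has_deriv] simp: algebra_simps)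
  have h01: "\<bar>1 - h t\<bar> \<le> 1" for t using h(2,3)[of t] by auto
  show thesis
  \<comment> \<open>\<open>B\<close> bounds the function itself. In its derivative,
    \<open>B'\<close> comes from differentiating \<open>f\<close>, where \<open>n \<ge> 1\<close>
    supplies the factor, and \<open>B * D\<close> from differentiating the cut-off, where the factor
    \<open>n\<close> really arises.\<close>
  proof (rule that[of "B + B' + B * D"], unfold F)
    show "B + B' + B * D > 0" using B B' D by (simp add: add_pos_pos)
    fix n :: nat and x :: real
    assume n: "1 \<le> n"
    have "\<bar>f x * (1 - h (real n * \<sigma> * (x - c)))\<bar> \<le> B * 1"
      unfolding abs_mult using B h01 by (intro mult_mono) auto
    moreover have "B * D \<ge> 0" using B D by simp
    ultimately show "\<bar>f x * (1 - h (real n * \<sigma> * (x - c)))\<bar> \<le> B + B' + B * D"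
      using B' by linarith
    have "\<bar>deriv f x * (1 - h (real n * \<sigma> * (x - c)))\<bar> \<le> B' * 1"
      unfolding abs_mult using B' h01 by (intro mult_mono) auto
    also have "B' * 1 \<le> B' * real n" using B' n by (intro mult_left_mono) auto
    finally have 1: "\<bar>deriv f x * (1 - h (real n * \<sigma> * (x - c)))\<bar> \<le> B' * real n" .
    have "\<bar>f x * (real n * \<sigma> * deriv h (real n * \<sigma> * (x - c)))\<bar> \<le> B * (real n * 1 * D)"
      unfolding abs_mult using B D n \<sigma> by (intro mult_mono) auto
    with 1 have "\<bar>deriv (\<lambda>x. f x * (1 - h (real n * \<sigma> * (x - c)))) x\<bar> \<le> B' * real n + B * D * real n"
      unfolding deriv by (simp add: mult_ac)
    moreover have "B * real n \<ge> 0" using B by simp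
    ultimately show "\<bar>deriv (\<lambda>x. f x * (1 - h (real n * \<sigma> * (x - c)))) x\<bar> \<le> (B + B' + B * D) * real n"
      by (simp add: algebra_simps)
    assume "\<sigma> * (x - c) > 2 / real n"
    then have "real n * \<sigma> * (x - c) > 2" using n by (simp add: field_simps)
    then show "deriv (\<lambda>x. f x * (1 - h (real n * \<sigma> * (x - c)))) x = 0"
      unfolding deriv using h by auto
  qed
qed

lemma measure_lborel_square:
  fixes c d r :: real
  assumes "r \<ge> 0"
  shows "measure lborel (cball c r \<times> cball d r) = 4 * r\<^sup>2"
proof -
  have "cball c r \<times> cball d r = cbox (c - r, d - r) (c + r, d + r)"
    by (simp add: cball_eq_atLeastAtMost cbox_Pair_eq)
  then show ?thesis
    using assms by (simp add: content_Pair power2_eq_square)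
qed

text \<open>The point \<open>(c, d)\<close> is the corner, and \<open>\<sigma>\<close>,
  \<open>\<tau>\<close> point from it into the rectangle. The product \<open>f k\<close> is split
  into a part vanishing near \<open>x = c\<close>, a part vanishing near \<open>y = d\<close>, and a
  part which, where \<open>U\<close> or \<open>G\<close> is nonzero, lives in a square of side of
  order \<open>1/n\<close> at the corner. By \<open>X\<close> and \<open>Y\<close> the first two
  contribute nothing, so the third has a contribution independent of \<open>n\<close>, and this
  tends to 0.\<close>

lemma green_corner:
  assumes h: "smooth1 h" "\<And>t. 0 \<le> h t" "\<And>t. h t \<le> 1" "\<And>t. t \<le> 1 \<Longrightarrow> h t = 0" "\<And>t. t \<ge> 2 \<Longrightarrow> h t = 1"
      "\<And>t. t \<notin> {1..2} \<Longrightarrow> deriv h t = 0"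
    and f: "test_fun f A" and k: "test_fun k B"
    and sgn: "\<bar>\<sigma>\<bar> = 1" "\<bar>\<tau>\<bar> = 1"
    and U: "integrable lborel U" "integrable lborel (\<lambda>p. (U p)\<^sup>2)"
    and G: "integrable lborel G" "integrable lborel (\<lambda>p. (G p)\<^sup>2)"
    and zero: "\<And>p. \<sigma> * (fst p - c) \<le> 0 \<or> \<tau> * (snd p - d) \<le> 0 \<Longrightarrow> U p = 0 \<and> G p = 0"
    and X: "\<And>n::nat. (1::nat) \<le> n \<Longrightarrow> green lam U G (\<lambda>x. f x * h (real n * \<sigma> * (x - c))) k = 0"
    and Y: "\<And>n::nat. (1::nat) \<le> n \<Longrightarrow> green lam U G (\<lambda>x. f x * (1 - h (real n * \<sigma> * (x - c)))) (\<lambda>y. k y * h (real n * \<tau> * (y - d))) = 0"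
  shows "green lam U G f k = 0"
proof -
  define F where "F n x = f x * (1 - h (real n * \<sigma> * (x - c)))" for n :: nat and x :: real
  define K where "K n y = k y * (1 - h (real n * \<tau> * (y - d)))" for n :: nat and y :: real
  have smh: "smooth1 (\<lambda>x. h (real n * s * (x - e)))" "smooth1 (\<lambda>x. 1 - h (real n * s * (x - e)))" for n :: nat and s e :: real
    using smooth1_affine[OF h(1), of 1 "real n * s" "- real n * s * e"]
      smooth1_add[OF smooth1_const[of 1] smooth1_affine[OF h(1), of "-1" "real n * s" "- real n * s * e"]]
    by (simp_all add: algebra_simps)
  have tf: "test_fun (\<lambda>x. f x * h (real n * \<sigma> * (x - c))) A" "test_fun (F n) A"
    "test_fun (\<lambda>y. k y * h (real n * \<tau> * (y - d))) B" "test_fun (K n) B" for n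
    using test_fun_mult[OF f smh(1) closed_UNIV] test_fun_mult[OF f smh(2) closed_UNIV]
      test_fun_mult[OF k smh(1) closed_UNIV] test_fun_mult[OF k smh(2) closed_UNIV]
    unfolding F_def[abs_def] K_def[abs_def] by simp_all
  \<comment> \<open>Written with cut-offs \<open>a\<close> and \<open>b\<close> in the two
    variables, this is \<open>f k = (f a) k + f (1 - a) (k b) + f (1 - a) k (1 - b)\<close>;
    hypotheses \<open>X\<close> and \<open>Y\<close> remove the first two terms.\<close>
  have I: "green lam U G f k = green lam U G (F n) (K n)" if "(1::nat) \<le> n" for n
  proof -
    have "green lam U G f k = green lam U G (\<lambda>x. f x * h (real n * \<sigma> * (x - c)) + F n x) k"
      by (simp add: F_def algebra_simps)
    also have "\<dots> = green lam U G (F n) k"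
      using X[OF that] green_add_left[OF tf(1,2) k U(1) G(1)] by simp
    also have "\<dots> = green lam U G (F n) (\<lambda>y. k y * h (real n * \<tau> * (y - d)) + K n y)"
      by (simp add: K_def algebra_simps)
    also have "\<dots> = green lam U G (F n) (K n)"
      using Y[OF that] green_add_right[OF tf(2,3,4) U(1) G(1)] by (simp add: F_def[abs_def])
    finally show ?thesis .
  qed
  obtain C1 :: real where C1: "C1 > 0" "\<And>n x. (1::nat) \<le> n \<Longrightarrow> \<bar>F n x\<bar> \<le> C1"
    "\<And>n x. (1::nat) \<le> n \<Longrightarrow> \<bar>deriv (F n) x\<bar> \<le> C1 * real n"
    "\<And>n x. (1::nat) \<le> n \<Longrightarrow> \<sigma> * (x - c) > 2 / real n \<Longrightarrow> deriv (F n) x = 0"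
    using green_corner_bound[OF h(1-3,5,6) f sgn(1) F_def[abs_def, THEN meta_eq_to_obj_eq]] by blast
  obtain C2 :: real where C2: "C2 > 0" "\<And>n x. (1::nat) \<le> n \<Longrightarrow> \<bar>K n x\<bar> \<le> C2"
    "\<And>n x. (1::nat) \<le> n \<Longrightarrow> \<bar>deriv (K n) x\<bar> \<le> C2 * real n"
    "\<And>n x. (1::nat) \<le> n \<Longrightarrow> \<tau> * (x - d) > 2 / real n \<Longrightarrow> deriv (K n) x = 0"
    using green_corner_bound[OF h(1-3,5,6) k sgn(2) K_def[abs_def, THEN meta_eq_to_obj_eq]] by blast
  have F0: "F n x = 0" if "(1::nat) \<le> n" "\<sigma> * (x - c) > 2 / real n" for n x
    using that h(5)[of "real n * \<sigma> * (x - c)"] by (simp add: F_def field_simps)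
  have K0: "K n x = 0" if "(1::nat) \<le> n" "\<tau> * (x - d) > 2 / real n" for n x
    using that h(5)[of "real n * \<tau> * (x - d)"] by (simp add: K_def field_simps)
  define C where "C = C1 * C2 * (\<bar>lam\<bar> + 1)"
  have C: "C > 0" using C1 C2 by (simp add: C_def)
  define S where "S n = cball c (2 / real n) \<times> cball d (2 / real n)" for n :: nat
  have S_sets [measurable]: "S n \<in> sets borel" for n by (simp add: S_def borel_closed closed_Times)
  have S_fin: "emeasure lborel (S n) < \<infinity>" for n
    by (intro emeasure_bounded_finite) (simp add: S_def bounded_Times)
  define W where "W p = (U p)\<^sup>2 + (G p)\<^sup>2" for p
  have W: "integrable lborel W" unfolding W_def[abs_def] using U G by simp
  have Wn: "integrable lborel (\<lambda>p. W p * indicator (S n) p)" for n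
    by (intro integrable_mult_indicator[of _ lborel W, simplified mult.commute real_scaleR_def] W) auto
  have pw: "\<bar>U p * (lam * tensor (deriv (F n)) (K n) p + tensor (F n) (deriv (K n)) p) + G p * tensor (F n) (K n) p\<bar>
      \<le> C * (2 * t * (real n)\<^sup>2 * indicator (S n) p + W p * indicator (S n) p / t)" if n: "(1::nat) \<le> n" and t: "t > 0" for n p t
  \<comment> \<open>The integrand vanishes off \<open>S n\<close>: behind one of the two lines
    because \<open>U\<close> and \<open>G\<close> do, and further than \<open>2 / n\<close> beyond
    one of them because \<open>F n\<close> or \<open>K n\<close> vanishes there together with its
    derivative.\<close>
  proof (cases "(U p = 0 \<and> G p = 0) \<or> \<sigma> * (fst p - c) > 2 / real n \<or> \<tau> * (snd p - d) > 2 / real n")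
    case True
    then have "U p * (lam * tensor (deriv (F n)) (K n) p + tensor (F n) (deriv (K n)) p) + G p * tensor (F n) (K n) p = 0"
      using F0[OF n] K0[OF n] C1(4)[OF n] C2(4)[OF n] by (auto simp: tensor_def)
    then show ?thesis using C t by (simp add: W_def)
  next
    case False
    then have pos: "\<sigma> * (fst p - c) > 0" "\<tau> * (snd p - d) > 0" using zero[of p] by linarith+
    then have "\<bar>fst p - c\<bar> = \<sigma> * (fst p - c)" "\<bar>snd p - d\<bar> = \<tau> * (snd p - d)"
      using sgn by (metis abs_mult abs_of_pos mult_1)+
    with False have pS: "p \<in> S n" by (auto simp: S_def dist_real_def abs_minus_commute mem_Times_iff)
    have n1: "1 \<le> real n" using n by simp
    have "\<bar>tensor (deriv (F n)) (K n) p\<bar> \<le> C1 * real n * C2"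
      unfolding tensor_def abs_mult using C1 C2 n by (intro mult_mono) auto
    moreover have "\<bar>tensor (F n) (deriv (K n)) p\<bar> \<le> C1 * (C2 * real n)"
      unfolding tensor_def abs_mult using C1 C2 n by (intro mult_mono) auto
    ultimately have "\<bar>lam * tensor (deriv (F n)) (K n) p + tensor (F n) (deriv (K n)) p\<bar> \<le> \<bar>lam\<bar> * (C1 * real n * C2) + C1 * (C2 * real n)"
      by (intro order_trans[OF abs_triangle_ineq] add_mono) (auto simp: abs_mult intro: mult_left_mono)
    then have a: "\<bar>lam * tensor (deriv (F n)) (K n) p + tensor (F n) (deriv (K n)) p\<bar> \<le> C * real n"
      by (simp add: C_def algebra_simps)
    have "\<bar>tensor (F n) (K n) p\<bar> \<le> C1 * C2"
      unfolding tensor_def abs_mult using C1 C2 n by (intro mult_mono) auto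
    also have "\<dots> \<le> C1 * C2 * ((\<bar>lam\<bar> + 1) * n)"
      using C1 C2 mult_mono[of 1 "\<bar>lam\<bar> + 1" 1 "real n"] n1 by simp
    finally have b: "\<bar>tensor (F n) (K n) p\<bar> \<le> C * real n" by (simp add: C_def mult_ac)
    \<comment> \<open>The cut-off gradient costs a factor \<open>n\<close>.  AM-GM with weight \<open>t\<close> trades it for \<open>t n\<^sup>2\<close> times the
      area \<open>16 / n\<^sup>2\<close> of the square, plus the mass of \<open>U\<^sup>2 + G\<^sup>2\<close> on that shrinking square.\<close>
    have amgm: "n * \<bar>z\<bar> \<le> t * (real n)\<^sup>2 + z\<^sup>2 / t" for z :: real
    proof -
      have "0 \<le> (t * n - \<bar>z\<bar>)\<^sup>2 + t * n * \<bar>z\<bar>" using t by simp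
      then have "t * n * \<bar>z\<bar> \<le> (t * n)\<^sup>2 + z\<^sup>2"
        unfolding power2_diff power2_abs by (simp add: mult_ac)
      then show ?thesis using t by (simp add: field_simps power2_eq_square)
    qed
    have "\<bar>U p * (lam * tensor (deriv (F n)) (K n) p + tensor (F n) (deriv (K n)) p) + G p * tensor (F n) (K n) p\<bar>
        \<le> \<bar>U p\<bar> * (C * n) + \<bar>G p\<bar> * (C * n)"
      using a b by (intro order_trans[OF abs_triangle_ineq] add_mono) (auto simp: abs_mult intro: mult_left_mono)
    also have "\<dots> = C * (n * \<bar>U p\<bar> + n * \<bar>G p\<bar>)" by (simp add: algebra_simps)
    also have "\<dots> \<le> C * ((t * (real n)\<^sup>2 + (U p)\<^sup>2 / t) + (t * (real n)\<^sup>2 + (G p)\<^sup>2 / t))"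
      using amgm C by (intro mult_left_mono add_mono) auto
    finally show ?thesis using pS by (simp add: W_def add_divide_distrib algebra_simps)
  qed
  have bound: "\<bar>green lam U G f k\<bar> \<le> C * (32 * t + (\<integral>p. W p * indicator (S n) p \<partial>lborel) / t)" if n: "(1::nat) \<le> n" and t: "t > 0" for n t
  proof -
    have iS: "integrable lborel (indicator (S n) :: _ \<Rightarrow> real)" using S_fin by (intro integrable_real_indicator) auto
    have "\<bar>green lam U G f k\<bar> \<le> (\<integral>p. C * (2 * t * (real n)\<^sup>2 * indicator (S n) p + W p * indicator (S n) p / t) \<partial>lborel)"
      unfolding I[OF n] unfolding green_def
      using green_integrable[OF tf(2,4) U(1) G(1)] iS Wn pw[OF n t]
      by (intro integral_abs_bound_integral) auto
    also have "\<dots> = C * (2 * t * (real n)\<^sup>2 * measure lborel (S n) + (\<integral>p. W p * indicator (S n) p \<partial>lborel) / t)"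
      using iS Wn by simp
    also have "2 * t * (real n)\<^sup>2 * measure lborel (S n) = 32 * t"
      using n by (simp add: S_def measure_lborel_square power2_eq_square)
    finally show ?thesis .
  qed
  have "(\<lambda>n. \<integral>p. W p * indicator (S n) p \<partial>lborel) \<longlonglongrightarrow> integral\<^sup>L lborel (\<lambda>p::real\<times>real. 0)"
  proof (rule integral_dominated_convergence[OF _ _ W])
    show "AE p in lborel. (\<lambda>n. W p * indicator (S n) p) \<longlonglongrightarrow> 0"
    proof (intro AE_I2 tendsto_eventually)
      fix p
      \<comment> \<open>The squares shrink to the corner, so a point off the line
        \<open>x = c\<close> leaves them eventually. On that line \<open>W\<close> is 0 by the
        hypothesis \<open>zero\<close>.\<close>
      show "\<forall>\<^sub>F n in sequentially. W p * indicator (S n) p = 0"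
      proof (cases "fst p = c")
        case True
        with zero[of p] show ?thesis by (simp add: W_def)
      next
        case False
        have "(\<lambda>n. 2 / real n) \<longlonglongrightarrow> 0" by (rule lim_const_over_n)
        then have "\<forall>\<^sub>F n in sequentially. 2 / real n < \<bar>fst p - c\<bar>"
          using False by (intro order_tendstoD) auto
        then show ?thesis
          by eventually_elim (auto simp: S_def dist_real_def abs_minus_commute mem_Times_iff)
      qed
    qed
    show "AE p in lborel. norm (W p * indicator (S n) p) \<le> W p" for n
      by (auto simp: W_def split: split_indicator)
  qed (use Wn W in auto)
  then have w0: "(\<lambda>n. \<integral>p. W p * indicator (S n) p \<partial>lborel) \<longlonglongrightarrow> 0" by simp
  \<comment> \<open>The order of the limits matters: \<open>n\<close> tends to infinity with
    \<open>t\<close> fixed, which removes the term divided by \<open>t\<close>; afterwards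
    \<open>t\<close> is made small.\<close>
  have "\<bar>green lam U G f k\<bar> \<le> C * (32 * t)" if "t > 0" for t
  proof -
    have "(\<lambda>n. C * (32 * t + (\<integral>p. W p * indicator (S n) p \<partial>lborel) / t)) \<longlonglongrightarrow> C * (32 * t + 0 / t)"
      using that by (intro tendsto_intros w0) auto
    then show ?thesis
      using bound[OF _ that] by (intro tendsto_lowerbound[where F = sequentially]) (auto intro: eventually_sequentiallyI[of 1])
  qed
  note le = this
  have "\<bar>green lam U G f k\<bar> \<le> 0 + e" if "e > 0" for e
    using le[of "e / (32 * C)"] that C by simp
  then have "\<bar>green lam U G f k\<bar> \<le> 0" by (rule field_le_epsilon)
  then show ?thesis by simp
qed

subsection \<open>Shifted kernels and smoothness of the convolution\<close>

fun side_pos :: "real \<Rightarrow> real \<Rightarrow> side \<Rightarrow> real" where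
  "side_pos L1 L2 West = 0" | "side_pos L1 L2 East = L1" | "side_pos L1 L2 South = 0" | "side_pos L1 L2 North = L2"

fun opposite :: "side \<Rightarrow> side" where
  "opposite West = East" | "opposite East = West" | "opposite South = North" | "opposite North = South"

fun inward :: "side \<Rightarrow> real" where
  "inward West = 1" | "inward East = -1" | "inward South = 1" | "inward North = -1"

lemma abs_inward [simp]: "\<bar>inward s\<bar> = 1" "inward s * inward s = 1"
  by (cases s; simp)+

lemma side_cases: "s \<in> {sx, opposite sx, sy, opposite sy}" if "sx \<in> {West, East}" "sy \<in> {South, North}"
  using that by (cases s) auto

lemma side_set_pos:
  "sx \<in> {West, East} \<Longrightarrow> p \<in> side_set L1 L2 sx \<Longrightarrow> fst p = side_pos L1 L2 sx"
  "sy \<in> {South, North} \<Longrightarrow> p \<in> side_set L1 L2 sy \<Longrightarrow> snd p = side_pos L1 L2 sy"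
  by auto

lemma inward_pos_if_in_Omega:
  assumes "p \<in> Omega L1 L2"
  shows "sx \<in> {West, East} \<Longrightarrow> inward sx * (fst p - side_pos L1 L2 sx) > 0"
    "sy \<in> {South, North} \<Longrightarrow> inward sy * (snd p - side_pos L1 L2 sy) > 0"
  using assms by (auto simp: Omega_def)

text \<open>This is \<open>green_corner\<close> at the corner where \<open>sx\<close> and
  \<open>sy\<close> meet. The set \<open>A \<times> B\<close> stays off the two opposite sides; once
  the test function is also cut off from \<open>sx\<close>, it can meet only \<open>sy\<close>, so
  the trace condition on \<open>sy\<close> applies to it, and conversely.\<close>

lemma green_adjacent:
  fixes u g :: "real \<times> real \<Rightarrow> real" and L1 L2 :: real
  defines "U \<equiv> \<lambda>p. indicator (Omega L1 L2) p * u p" and "G \<equiv> \<lambda>p. indicator (Omega L1 L2) p * g p"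
  assumes sx: "sx \<in> {West, East}" and sy: "sy \<in> {South, North}"
    and tzx: "trace_zero L1 L2 lam u g sx" and tzy: "trace_zero L1 L2 lam u g sy"
    and f: "test_fun f A" "side_pos L1 L2 (opposite sx) \<notin> A"
    and k: "test_fun k B" "side_pos L1 L2 (opposite sy) \<notin> B"
    and U: "integrable lborel U" "integrable lborel (\<lambda>p. (U p)\<^sup>2)"
    and G: "integrable lborel G" "integrable lborel (\<lambda>p. (G p)\<^sup>2)"
  shows "green lam U G f k = 0"
proof -
  define c where "c = side_pos L1 L2 sx"
  define d where "d = side_pos L1 L2 sy"
  obtain h where h: "smooth1 h" "\<And>t. t \<le> 1 \<Longrightarrow> h t = 0" "\<And>t. t \<ge> 2 \<Longrightarrow> h t = 1" "\<And>t. 0 \<le> h t"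
    "\<And>t. h t \<le> 1" "\<And>t. t \<notin> {1..2} \<Longrightarrow> deriv h t = 0"
    using smooth1_step_exists by metis
  have opp: "opposite sx \<in> {West, East}" "opposite sy \<in> {South, North}" using sx sy by auto
  have smh: "smooth1 (\<lambda>x. h (real n * s * (x - e)))" "smooth1 (\<lambda>x. 1 - h (real n * s * (x - e)))" for n s e
    using smooth1_affine[OF h(1), of 1 "real n * s" "- real n * s * e"]
      smooth1_add[OF smooth1_const[of 1] smooth1_affine[OF h(1), of "-1" "real n * s" "- real n * s * e"]]
    by (simp_all add: algebra_simps)
  \<comment> \<open>A closed half-line outside which the cut-off vanishes. It misses
    \<open>e\<close> itself, so a set of the form \<open>A \<inter> C n s e\<close> keeps a positive
    distance from the line of the side.\<close>
  define C where "C n s e = {x. real n * s * (x - e) \<ge> 1}" for n s e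
  have C: "closed (C n s e)" for n s e
    unfolding C_def by (intro closed_Collect_le continuous_intros)
  have hC: "h (real n * s * (x - e)) = 0" if "x \<notin> C n s e" for n s e x
    using that h(2) by (simp add: C_def)
  have eC: "e \<notin> C n s e" for n s e by (simp add: C_def)
  show ?thesis
  proof (rule green_corner[where c = c and d = d, OF h(1,4,5,2,3,6) f(1) k(1) abs_inward(1)[of sx] abs_inward(1)[of sy] U G])
    show "U p = 0 \<and> G p = 0" if "inward sx * (fst p - c) \<le> 0 \<or> inward sy * (snd p - d) \<le> 0" for p
      using that inward_pos_if_in_Omega[of p L1 L2] sx sy unfolding c_def d_def U_def G_def
      by (cases "p \<in> Omega L1 L2") fastforce+
    fix n :: nat
    have fh: "test_fun (\<lambda>x. f x * h (real n * inward sx * (x - c))) (A \<inter> C n (inward sx) c)"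
      by (rule test_fun_mult[OF f(1) smh(1) C hC])
    show "green lam U G (\<lambda>x. f x * h (real n * inward sx * (x - c))) k = 0"
      unfolding U_def G_def
    proof (rule trace_zero_green[OF tzy fh k(1)], rule equals0I)
      fix z assume "z \<in> ((A \<inter> C n (inward sx) c) \<times> B) \<inter> (\<Union>s'\<in>UNIV - {sy}. side_set L1 L2 s')"
      then obtain s where s: "s \<noteq> sy" "z \<in> side_set L1 L2 s" and z: "z \<in> (A \<inter> C n (inward sx) c) \<times> B"
        by blast
      from z have "fst z \<in> A" "snd z \<in> B" "fst z \<in> C n (inward sx) c" by auto
      note s = s this
      with side_cases[OF sx sy, of s] consider "s = sx" | "s = opposite sx" | "s = opposite sy" by auto
      then show False
        using s f k eC[of c] side_set_pos(1)[OF sx, of z L1 L2] side_set_pos(1)[OF opp(1), of z L1 L2]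
          side_set_pos(2)[OF opp(2), of z L1 L2]
        by cases (auto simp: c_def)
    qed
    have fh: "test_fun (\<lambda>x. f x * (1 - h (real n * inward sx * (x - c)))) (A \<inter> UNIV)"
      by (rule test_fun_mult[OF f(1) smh(2)]) auto
    have kh: "test_fun (\<lambda>y. k y * h (real n * inward sy * (y - d))) (B \<inter> C n (inward sy) d)"
      by (rule test_fun_mult[OF k(1) smh(1) C hC])
    show "green lam U G (\<lambda>x. f x * (1 - h (real n * inward sx * (x - c)))) (\<lambda>y. k y * h (real n * inward sy * (y - d))) = 0"
      unfolding U_def G_def
    proof (rule trace_zero_green[OF tzx fh kh], rule equals0I)
      fix z assume "z \<in> ((A \<inter> UNIV) \<times> (B \<inter> C n (inward sy) d)) \<inter> (\<Union>s'\<in>UNIV - {sx}. side_set L1 L2 s')"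
      then obtain s where s: "s \<noteq> sx" "z \<in> side_set L1 L2 s" and z: "z \<in> (A \<inter> UNIV) \<times> (B \<inter> C n (inward sy) d)"
        by blast
      from z have "fst z \<in> A" "snd z \<in> B" "snd z \<in> C n (inward sy) d" by auto
      note s = s this
      with side_cases[OF sx sy, of s] consider "s = sy" | "s = opposite sx" | "s = opposite sy" by auto
      then show False
        using s f k eC[of d] side_set_pos(2)[OF sy, of z L1 L2] side_set_pos(1)[OF opp(1), of z L1 L2]
          side_set_pos(2)[OF opp(2), of z L1 L2]
        by cases (auto simp: d_def)
    qed
  qed
qed

section \<open>Kernels supported on one side of the origin\<close>

lemma kernel_exists:
  assumes "r > 0" "\<bar>s\<bar> = (1::real)"
  obtains \<rho> where "test_fun \<rho> {t. s * t \<in> {r..2 * r}}" "\<And>t. \<rho> t \<ge> 0" "has_bochner_integral lborel \<rho> 1"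
proof -
  obtain h where h: "smooth1 h" "\<And>t. t \<le> 1 \<Longrightarrow> h t = 0" "\<And>t. t \<ge> 2 \<Longrightarrow> h t = 1"
    "\<And>t. 0 \<le> deriv h t" "\<And>t. t \<notin> {1..2} \<Longrightarrow> deriv h t = 0"
    using smooth1_step_exists by metis
  define \<rho> where "\<rho> t = 1 / r * deriv h (s / r * t + 0)" for t
  have s2: "s * s = 1" using assms(2) by (simp add: abs_if split: if_splits)
  have sm: "smooth1 \<rho>"
    unfolding \<rho>_def[abs_def] by (intro smooth1_affine smooth1_deriv h)
  have zero: "\<rho> t = 0" if "s * t \<notin> {r..2 * r}" for t
    using that \<open>r > 0\<close> h(5)[of "s / r * t"] by (auto simp: \<rho>_def field_simps)
  have "{t. s * t \<in> {r..2 * r}} = (if s = 1 then {r..2 * r} else {- 2 * r..- r})"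
    using assms(2) by (auto simp: abs_if split: if_splits)
  then have "compact {t. s * t \<in> {r..2 * r}}" by simp
  with sm zero have tf: "test_fun \<rho> {t. s * t \<in> {r..2 * r}}" by (simp add: test_fun_def)
  \<comment> \<open>This antiderivative increases by \<open>h 3 - h (-3) = 1\<close> over
    \<open>[-3r, 3r]\<close> for either sign of \<open>s\<close>, since the outer factor
    \<open>s\<close> compensates the reflection of the argument.\<close>
  have "((\<lambda>t. s * h (s / r * t)) has_real_derivative \<rho> t) (at t)" for t
  proof -
    have "((\<lambda>t. h (s / r * t)) has_real_derivative deriv h (s / r * t) * (s / r)) (at t)"
      by (rule DERIV_chain2[OF smooth1_has_deriv[OF h(1)]]) (use \<open>r > 0\<close> in \<open>auto intro!: derivative_eq_intros\<close>)
    moreover have "s * (deriv h (s / r * t) * (s / r)) = \<rho> t"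
      using s2 \<open>r > 0\<close> by (simp add: \<rho>_def)
    ultimately show ?thesis using DERIV_cmult by metis
  qed
  then have "has_bochner_integral lborel (\<lambda>t. \<rho> t * indicator {- 3 * r..3 * r} t) (s * h (s / r * (3 * r)) - s * h (s / r * (- 3 * r)))"
    using \<open>r > 0\<close> sm smooth1_continuous[OF sm, of UNIV]
    by (intro has_bochner_integral_FTC_Icc_real) (auto simp: continuous_on_eq_continuous_at)
  also have "(\<lambda>t. \<rho> t * indicator {- 3 * r..3 * r} t) = \<rho>"
  proof
    fix t
    have "\<bar>s * t\<bar> = \<bar>t\<bar>" using assms(2) by (simp add: abs_mult)
    then show "\<rho> t * indicator {- 3 * r..3 * r} t = \<rho> t"
      using zero[of t] \<open>r > 0\<close> by (cases "s * t \<in> {r..2 * r}") (auto simp: indicator_def)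
  qed
  also have "s * h (s / r * (3 * r)) - s * h (s / r * (- 3 * r)) = 1"
    using assms h(2)[of "-3"] h(3)[of 3] by (auto simp: abs_if split: if_splits)
  finally have int: "has_bochner_integral lborel \<rho> 1" .
  have "\<rho> t \<ge> 0" for t
    using h(4) \<open>r > 0\<close> by (simp add: \<rho>_def)
  then show thesis
    by (rule that[OF tf _ int])
qed

lemma mollifier_tensor:
  assumes f: "test_fun f {t. s * t \<in> {r..2 * r}}" "\<And>t. f t \<ge> 0" "has_bochner_integral lborel f 1"
    and k: "test_fun k {t. s' * t \<in> {r..2 * r}}" "\<And>t. k t \<ge> 0" "has_bochner_integral lborel k 1"
    and s: "\<bar>s\<bar> = 1" "\<bar>s'\<bar> = 1" and "r > 0"
  shows "mollifier (tensor f k) (5 * r)"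
proof
  have sm: "smooth1 f" "smooth1 k" using f k by (auto simp: test_fun_def)
  show "continuous_on UNIV (tensor f k)" by (intro continuous_on_tensor sm)
  show "0 \<le> tensor f k z" for z using f k by (simp add: tensor_def)
  \<comment> \<open>Each coordinate is at most \<open>2 * r\<close> in absolute value on the
    support, hence \<open>norm z \<le> 4 * r\<close>; the radius \<open>5 * r\<close> makes the
    contradiction strict.\<close>
  show "tensor f k z = 0" if "5 * r \<le> norm z" for z
  proof (rule ccontr)
    assume "tensor f k z \<noteq> 0"
    then have "f (fst z) \<noteq> 0" "k (snd z) \<noteq> 0" by (auto simp: tensor_def)
    then have "s * fst z \<in> {r..2 * r}" "s' * snd z \<in> {r..2 * r}" using f(1) k(1) by (auto simp: test_fun_def)
    then have "\<bar>s * fst z\<bar> \<le> 2 * r" "\<bar>s' * snd z\<bar> \<le> 2 * r" using \<open>r > 0\<close> by auto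
    then have "norm z \<le> 4 * r" using norm_Pair_le[of "fst z" "snd z"] s by (simp add: abs_mult)
    with that \<open>r > 0\<close> show False by simp
  qed
  have "integrable lborel (\<lambda>p. indicator ({t. s * t \<in> {r..2 * r}} \<times> {t. s' * t \<in> {r..2 * r}}) p *\<^sub>R tensor f k p)"
    using f k by (intro borel_integrable_compact compact_Times continuous_on_tensor sm) (auto simp: test_fun_def)
  also have "(\<lambda>p. indicator ({t. s * t \<in> {r..2 * r}} \<times> {t. s' * t \<in> {r..2 * r}}) p *\<^sub>R tensor f k p) = tensor f k"
    using f k by (auto simp: test_fun_def tensor_def fun_eq_iff indicator_def)
  finally have int: "integrable lborel (tensor f k)" .
  have "integral\<^sup>L lborel (tensor f k) = (\<integral>x. \<integral>y. tensor f k (x, y) \<partial>lborel \<partial>lborel)"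
    using lborel_pair.integral_fst'[of "tensor f k"] int by (simp add: lborel_prod)
  also have "\<dots> = 1" using f(3) k(3) by (simp add: tensor_def has_bochner_integral_iff)
  finally show "has_bochner_integral lborel (tensor f k) 1" using int by (simp add: has_bochner_integral_iff)
qed

section \<open>Differentiation of the convolution\<close>

lemma abs_fst_snd_le_norm: "\<bar>fst h\<bar> \<le> norm h" "\<bar>snd h\<bar> \<le> norm h" for h :: "real \<times> real"
  using norm_fst_le[of "fst h" "snd h"] norm_snd_le[of "snd h" "fst h"] by simp_all

lemma tensor_lipschitz:
  assumes "test_fun f A" "test_fun k B"
  obtains C where "C > 0" "\<And>x y. \<bar>tensor f k x - tensor f k y\<bar> \<le> C * norm (x - y)"
proof -
  have sm: "smooth1 f" "smooth1 k" using assms by (auto simp: test_fun_def)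
  obtain C1 where C1: "C1 > 0" "\<And>p. \<bar>tensor (deriv f) k p\<bar> \<le> C1"
    using tensor_bounded[OF test_fun_deriv[OF assms(1)] assms(2)] by metis
  obtain C2 where C2: "C2 > 0" "\<And>p. \<bar>tensor f (deriv k) p\<bar> \<le> C2"
    using tensor_bounded[OF assms(1) test_fun_deriv[OF assms(2)]] by metis
  have "norm (tensor f k x - tensor f k y) \<le> (C1 + C2) * norm (x - y)" for x y
  proof (rule differentiable_bound[OF convex_UNIV])
    show "(tensor f k has_derivative (\<lambda>h. fst h * tensor (deriv f) k p + snd h * tensor f (deriv k) p)) (at p within UNIV)" for p
      using tensor_has_derivative[OF sm] by simp
    show "onorm (\<lambda>h. fst h * tensor (deriv f) k p + snd h * tensor f (deriv k) p) \<le> C1 + C2" for p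
    proof (rule onorm_bound)
      fix h :: "real \<times> real"
      have "norm (fst h * tensor (deriv f) k p + snd h * tensor f (deriv k) p) \<le> norm h * C1 + norm h * C2"
        using C1(1) C1(2)[of p] C2(1) C2(2)[of p] abs_fst_snd_le_norm[of h]
        by (intro norm_triangle_mono) (auto simp: abs_mult intro!: mult_mono)
      then show "norm (fst h * tensor (deriv f) k p + snd h * tensor f (deriv k) p) \<le> (C1 + C2) * norm h"
        by (simp add: algebra_simps)
    qed (use C1 C2 in simp)
  qed auto
  with C1 C2 show thesis by (intro that[of "C1 + C2"]) auto
qed

text \<open>The partial derivatives are again products of test functions, hence globally Lipschitz.
  One constant serves all pairs of points, so the remainder can be integrated against an integrable
  function.\<close>

lemma tensor_taylor:
  assumes "test_fun f A" "test_fun k B"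
  obtains C where "\<And>x y. \<bar>tensor f k y - tensor f k x -
      (fst (y - x) * tensor (deriv f) k x + snd (y - x) * tensor f (deriv k) x)\<bar> \<le> C * (norm (y - x))\<^sup>2"
proof -
  have sm: "smooth1 f" "smooth1 k" using assms by (auto simp: test_fun_def)
  obtain C1 where C1: "C1 > 0" "\<And>x y. \<bar>tensor (deriv f) k x - tensor (deriv f) k y\<bar> \<le> C1 * norm (x - y)"
    using tensor_lipschitz[OF test_fun_deriv[OF assms(1)] assms(2)] by metis
  obtain C2 where C2: "C2 > 0" "\<And>x y. \<bar>tensor f (deriv k) x - tensor f (deriv k) y\<bar> \<le> C2 * norm (x - y)"
    using tensor_lipschitz[OF assms(1) test_fun_deriv[OF assms(2)]] by metis
  define D where "D p h = fst h * tensor (deriv f) k p + snd h * tensor f (deriv k) p" for p h :: "real \<times> real"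
  have "norm (tensor f k y - tensor f k x - D x (y - x)) \<le> norm (y - x) * ((C1 + C2) * norm (y - x))" for x y
  proof (rule differentiable_bound_linearization)
    show "x + t *\<^sub>R (y - x) \<in> cball x (norm (y - x))" if "t \<in> {0..1}" for t
      using that by (simp add: dist_norm mult_left_le_one_le)
    show "(tensor f k has_derivative D p) (at p within cball x (norm (y - x)))" for p
      using tensor_has_derivative[OF sm, of p] unfolding D_def[abs_def] by (rule has_derivative_at_withinI)
    fix p assume "p \<in> cball x (norm (y - x))"
    then have p: "norm (p - x) \<le> norm (y - x)" by (simp add: dist_norm norm_minus_commute)
    show "onorm (D p - D x) \<le> (C1 + C2) * norm (y - x)"
    proof (rule onorm_bound)
      fix h :: "real \<times> real"
      have "norm ((D p - D x) h) = norm (fst h * (tensor (deriv f) k p - tensor (deriv f) k x)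
          + snd h * (tensor f (deriv k) p - tensor f (deriv k) x))"
        by (simp add: D_def algebra_simps)
      also have "\<dots> \<le> norm h * (C1 * norm (y - x)) + norm h * (C2 * norm (y - x))"
        using C1(1) C2(1) p abs_fst_snd_le_norm[of h]
          order_trans[OF C1(2)[of p x] mult_left_mono[OF p]] order_trans[OF C2(2)[of p x] mult_left_mono[OF p]]
        unfolding real_norm_def
        by (intro order_trans[OF abs_triangle_ineq] add_mono) (auto simp: abs_mult intro!: mult_mono)
      finally show "norm ((D p - D x) h) \<le> (C1 + C2) * norm (y - x) * norm h"
        by (simp add: algebra_simps)
    qed (use C1 C2 in simp)
  qed auto
  then show thesis
    by (intro that[of "C1 + C2"]) (simp add: D_def power2_eq_square mult_ac)
qed

lemma integrable_conv_tensor: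
  assumes "test_fun f A" "test_fun k B" "integrable lborel U"
  shows "integrable lborel (\<lambda>q. tensor f k (p - q) * U q)"
proof -
  obtain C where "\<And>p. \<bar>tensor f k p\<bar> \<le> C" using tensor_bounded[OF assms(1,2)] by metis
  moreover have "continuous_on UNIV (\<lambda>q. tensor f k (p - q))"
    by (rule continuous_on_compose2[OF continuous_on_tensor[of f k UNIV]])
      (use assms in \<open>auto simp: test_fun_def intro!: continuous_intros\<close>)
  ultimately show ?thesis
    using assms by (intro integrable_mult_bounded_continuous[of _ C])
qed

text \<open>The remainder of \<open>tensor_taylor\<close>, integrated against \<open>U\<close>, is
  at most the constant \<open>C\<close> times the integral of \<open>\<bar>U\<bar>\<close> times the
  squared increment. Thus the derivative passes to the kernel directly, without a limit under the
  integral sign.\<close>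

lemma conv_tensor_has_derivative:
  assumes f: "test_fun f A" and k: "test_fun k B" and U: "integrable lborel U"
  shows "(conv (tensor f k) U has_derivative
    (\<lambda>h. fst h * conv (tensor (deriv f) k) U p + snd h * conv (tensor f (deriv k)) U p)) (at p)"
proof -
  obtain C where C: "\<And>x y. \<bar>tensor f k y - tensor f k x -
      (fst (y - x) * tensor (deriv f) k x + snd (y - x) * tensor f (deriv k) x)\<bar> \<le> C * (norm (y - x))\<^sup>2"
    using tensor_taylor[OF f k] by metis
  note int = integrable_conv_tensor[OF f k U] integrable_conv_tensor[OF test_fun_deriv[OF f] k U]
    integrable_conv_tensor[OF f test_fun_deriv[OF k] U]
  define I where "I = (\<integral>q. \<bar>U q\<bar> \<partial>lborel)"
  have est: "\<bar>conv (tensor f k) U y - conv (tensor f k) U p -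
      (fst (y - p) * conv (tensor (deriv f) k) U p + snd (y - p) * conv (tensor f (deriv k)) U p)\<bar>
      \<le> C * I * (norm (y - p))\<^sup>2" for y
  proof -
    let ?R = "\<lambda>q. tensor f k (y - q) * U q - tensor f k (p - q) * U q -
        (fst (y - p) * (tensor (deriv f) k (p - q) * U q) + snd (y - p) * (tensor f (deriv k) (p - q) * U q))"
    have eq: "conv (tensor f k) U y - conv (tensor f k) U p -
      (fst (y - p) * conv (tensor (deriv f) k) U p + snd (y - p) * conv (tensor f (deriv k)) U p) = (\<integral>q. ?R q \<partial>lborel)"
      using int by (simp add: conv_def)
    have "\<bar>\<integral>q. ?R q \<partial>lborel\<bar> \<le> (\<integral>q. C * (norm (y - p))\<^sup>2 * \<bar>U q\<bar> \<partial>lborel)"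
    proof (rule integral_abs_bound_integral)
      show "\<bar>?R q\<bar> \<le> C * (norm (y - p))\<^sup>2 * \<bar>U q\<bar>" for q
      proof -
        have "\<bar>?R q\<bar> = \<bar>tensor f k (y - q) - tensor f k (p - q) -
            (fst (y - p) * tensor (deriv f) k (p - q) + snd (y - p) * tensor f (deriv k) (p - q))\<bar> * \<bar>U q\<bar>"
          by (simp add: algebra_simps flip: abs_mult)
        also have "\<dots> \<le> C * (norm (y - p))\<^sup>2 * \<bar>U q\<bar>"
          using C[of "y - q" "p - q"] by (intro mult_right_mono) simp_all
        finally show ?thesis .
      qed
    qed (use int U in auto)
    also have "\<dots> = C * I * (norm (y - p))\<^sup>2"
      unfolding I_def integral_mult_right_zero by (simp only: mult_ac)
    finally show ?thesis unfolding eq .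
  qed
  show ?thesis
  proof (rule has_derivativeI_sandwich[of 1])
    show "bounded_linear (\<lambda>h::real\<times>real. fst h * conv (tensor (deriv f) k) U p + snd h * conv (tensor f (deriv k)) U p)"
      by (intro bounded_linear_add bounded_linear_mult_const bounded_linear_fst bounded_linear_snd)
    show "norm (conv (tensor f k) U y - conv (tensor f k) U p -
      (fst (y - p) * conv (tensor (deriv f) k) U p + snd (y - p) * conv (tensor f (deriv k)) U p)) / norm (y - p)
      \<le> C * I * norm (y - p)" if "y \<noteq> p" for y
      using est[of y] that by (simp add: divide_simps power2_eq_square mult_ac)
    have "((\<lambda>y. C * I * norm (y - p)) \<longlongrightarrow> C * I * norm (p - p)) (at p)"
      by (intro tendsto_intros)
    then show "((\<lambda>y. C * I * norm (y - p)) \<longlongrightarrow> 0) (at p)" by simp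
  qed auto
qed

lemma continuous_conv_tensor:
  assumes "test_fun f A" "test_fun k B" "integrable lborel U"
  shows "continuous_on S (conv (tensor f k) U)"
  by (intro continuous_at_imp_continuous_on ballI has_derivative_continuous[OF conv_tensor_has_derivative[OF assms]])

lemma smooth2_conv_tensor:
  assumes "test_fun f A" "test_fun k B" "integrable lborel U"
  shows "smooth2 (conv (tensor f k) U)"
  unfolding smooth2_def
proof (intro exI[of _ "\<lambda>a b. conv (tensor ((deriv ^^ a) f) ((deriv ^^ b) k)) U"] conjI allI)
  fix a b p
  note t = test_fun_funpow_deriv[OF assms(1), of a] test_fun_funpow_deriv[OF assms(2), of b] assms(3)
  show "continuous_on UNIV (conv (tensor ((deriv ^^ a) f) ((deriv ^^ b) k)) U)"
    by (rule continuous_conv_tensor[OF t])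
  show "(conv (tensor ((deriv ^^ a) f) ((deriv ^^ b) k)) U has_derivative
          (\<lambda>h. fst h * conv (tensor ((deriv ^^ Suc a) f) ((deriv ^^ b) k)) U p +
               snd h * conv (tensor ((deriv ^^ a) f) ((deriv ^^ Suc b) k)) U p)) (at p)"
    using conv_tensor_has_derivative[OF t] by simp
qed simp

subsection \<open>The scalar equation\<close>

lemma smooth2_has_derivative:
  assumes "smooth2 f"
  shows "(f has_derivative (\<lambda>h. fst h * dx f p + snd h * dy f p)) (at p)"
    and "continuous_on S f" "continuous_on S (dx f)" "continuous_on S (dy f)"
proof -
  obtain D where D: "D 0 0 = f" "\<And>a b. continuous_on UNIV (D a b)"
    "\<And>a b p. (D a b has_derivative (\<lambda>h. fst h * D (Suc a) b p + snd h * D a (Suc b) p)) (at p)"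
    using assms unfolding smooth2_def by blast
  have "dx f = D 1 0" "dy f = D 0 1"
    using dx_eqI[OF D(3)[of 0 0]] D(1) by auto
  with D show "(f has_derivative (\<lambda>h. fst h * dx f p + snd h * dy f p)) (at p)"
    "continuous_on S f" "continuous_on S (dx f)" "continuous_on S (dy f)"
    using D(3)[of 0 0 p] continuous_on_subset[OF D(2) subset_UNIV, of S] by auto
qed

text \<open>Meant for \<open>Ph\<close> in the theorem, whose components combine the scalar
  approximations with the rows of \<open>matrix_inv Q\<close> as coefficients.\<close>

lemma smooth2_lincomb:
  fixes v :: "'i::finite \<Rightarrow> real \<times> real \<Rightarrow> real"
  assumes "\<And>i. smooth2 (v i)"
  shows "smooth2 (\<lambda>p. \<Sum>i\<in>UNIV. c i * v i p)"
proof -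
  have "\<exists>D. \<forall>i. D i 0 0 = v i \<and> (\<forall>a b. continuous_on UNIV (D i a b) \<and>
      (\<forall>p. (D i a b has_derivative (\<lambda>h. fst h * D i (Suc a) b p + snd h * D i a (Suc b) p)) (at p)))"
    using assms unfolding smooth2_def by (intro choice allI)
  then obtain D where D0: "\<And>i. D i 0 0 = v i" and Dc: "\<And>i a b. continuous_on UNIV (D i a b)"
    and Dd: "\<And>i a b p. (D i a b has_derivative (\<lambda>h. fst h * D i (Suc a) b p + snd h * D i a (Suc b) p)) (at p)"
    by blast
  show ?thesis
    unfolding smooth2_def
  proof (intro exI[of _ "\<lambda>a b p. \<Sum>i\<in>UNIV. c i * D i a b p"] conjI allI)
    fix a b p
    show "continuous_on UNIV (\<lambda>p. \<Sum>i\<in>UNIV. c i * D i a b p)"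
      by (intro continuous_intros Dc)
    have "((\<lambda>p. \<Sum>i\<in>UNIV. c i * D i a b p) has_derivative
        (\<lambda>h. \<Sum>i\<in>UNIV. c i * (fst h * D i (Suc a) b p + snd h * D i a (Suc b) p))) (at p)"
      by (intro has_derivative_sum has_derivative_mult_right Dd)
    then show "((\<lambda>p. \<Sum>i\<in>UNIV. c i * D i a b p) has_derivative
        (\<lambda>h. fst h * (\<Sum>i\<in>UNIV. c i * D i (Suc a) b p) + snd h * (\<Sum>i\<in>UNIV. c i * D i a (Suc b) p))) (at p)"
      by (rule has_derivative_eq_rhs) (simp add: fun_eq_iff sum_distrib_left sum.distrib algebra_simps)
  qed (simp add: D0)
qed

section \<open>Integration by parts on the rectangle\<close>

lemma Omega_sets [measurable]: "Omega L1 L2 \<in> sets borel"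
  unfolding Omega_def by (intro borel_open open_Times) auto

lemma bounded_Omega: "bounded (Omega L1 L2)"
  unfolding Omega_def by (intro bounded_Times) auto

lemma set_integrable_Omega_continuous:
  fixes w :: "real \<times> real \<Rightarrow> 'b::{banach, second_countable_topology}"
  assumes "continuous_on UNIV w" shows "set_integrable lborel (Omega L1 L2) w"
proof (rule set_integrable_subset)
  show "set_integrable lborel (OmegaBar L1 L2) w"
    unfolding set_integrable_def OmegaBar_def
    by (intro borel_integrable_compact compact_Times continuous_on_subset[OF assms]) auto
  show "Omega L1 L2 \<subseteq> OmegaBar L1 L2" by (auto simp: Omega_def OmegaBar_def)
qed simp

lemma integral_Ioo_deriv:
  fixes f F :: "real \<Rightarrow> real"
  assumes "0 < L" "\<And>x. (F has_real_derivative f x) (at x)" "continuous_on UNIV f"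
  shows "(\<integral>x. indicator {0<..<L} x * f x \<partial>lborel) = F L - F 0"
proof -
  have [measurable]: "f \<in> borel_measurable borel" using assms(3) by (rule borel_measurable_continuous_onI)
  have "(\<integral>x. indicator {0<..<L} x * f x \<partial>lborel) = (\<integral>x. f x * indicator {0..L} x \<partial>lborel)"
  proof (rule integral_cong_AE)
    show "AE x in lborel. indicator {0<..<L} x * f x = f x * indicator {0..L} x"
      using AE_lborel_singleton[of 0] AE_lborel_singleton[of L]
      by eventually_elim (auto simp: indicator_def)
  qed simp_all
  also have "\<dots> = F L - F 0"
    using assms by (intro integral_FTC_Icc_real) (auto simp: continuous_on_eq_continuous_at)
  finally show ?thesis .
qed

lemma integral_dx_dy_eq_0:
  assumes "L1 > 0" "L2 > 0"
    and deriv: "\<And>p. (w has_derivative (\<lambda>h. fst h * wx p + snd h * wy p)) (at p)"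
    and cont: "continuous_on UNIV wx" "continuous_on UNIV wy"
    and zero: "\<And>s p. p \<in> side_set L1 L2 s \<Longrightarrow> w p = 0"
  shows "(LINT p:Omega L1 L2|lborel. wx p) = 0" "(LINT p:Omega L1 L2|lborel. wy p) = 0"
proof -
  have ind: "indicator (Omega L1 L2) (x, y) = (indicator {0<..<L1} x * indicator {0<..<L2} y :: real)" for x y
    by (auto simp: Omega_def indicator_def)
  have wx: "((\<lambda>t. w (t, y)) has_real_derivative wx (x, y)) (at x)" for x y
  proof -
    have "((\<lambda>t. w (t, y)) has_derivative (\<lambda>h. h * wx (x, y))) (at x)"
      using has_derivative_compose[OF has_derivative_Pair[OF has_derivative_ident has_derivative_const], of w _ x y UNIV] deriv[of "(x, y)"]
      by fastforce
    then show ?thesis by (simp add: has_field_derivative_def mult_commute_abs)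
  qed
  have wy: "((\<lambda>t. w (x, t)) has_real_derivative wy (x, y)) (at y)" for x y
  proof -
    have "((\<lambda>t. w (x, t)) has_derivative (\<lambda>h. h * wy (x, y))) (at y)"
      using has_derivative_compose[OF has_derivative_Pair[OF has_derivative_const has_derivative_ident], of w _ x y UNIV] deriv[of "(x, y)"]
      by fastforce
    then show ?thesis by (simp add: has_field_derivative_def mult_commute_abs)
  qed
  have ix: "(\<integral>x. indicator {0<..<L1} x * wx (x, y) \<partial>lborel) = w (L1, y) - w (0, y)" for y
    by (intro integral_Ioo_deriv wx assms continuous_on_compose2[OF cont(1)] continuous_intros) auto
  have iy: "(\<integral>y. indicator {0<..<L2} y * wy (x, y) \<partial>lborel) = w (x, L2) - w (x, 0)" for x
    by (intro integral_Ioo_deriv wy assms continuous_on_compose2[OF cont(2)] continuous_intros) auto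
  have int: "integrable lborel (\<lambda>(x, y). indicator (Omega L1 L2) (x, y) * v (x, y) :: real)" if "continuous_on UNIV v" for v
    using set_integrable_Omega_continuous[OF that, of L1 L2] by (simp add: set_integrable_def split_def)
  have "(LINT p:Omega L1 L2|lborel. wx p) = (\<integral>y. \<integral>x. indicator (Omega L1 L2) (x, y) * wx (x, y) \<partial>lborel \<partial>lborel)"
    using lborel_pair.integral_snd[of "\<lambda>x y. indicator (Omega L1 L2) (x, y) * wx (x, y)"] int[OF cont(1)]
    by (simp add: lborel_prod set_lebesgue_integral_def split_def)
  also have "\<dots> = (\<integral>y. indicator {0<..<L2} y * (\<integral>x. indicator {0<..<L1} x * wx (x, y) \<partial>lborel) \<partial>lborel)"
    unfolding ind by (simp add: mult_ac flip: integral_mult_right_zero)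
  also have "\<dots> = (\<integral>y. 0 \<partial>(lborel :: real measure))"
    unfolding ix using zero[of _ East] zero[of _ West]
    by (intro Bochner_Integration.integral_cong) (auto simp: indicator_def)
  finally show "(LINT p:Omega L1 L2|lborel. wx p) = 0" by simp
  have "(LINT p:Omega L1 L2|lborel. wy p) = (\<integral>x. \<integral>y. indicator (Omega L1 L2) (x, y) * wy (x, y) \<partial>lborel \<partial>lborel)"
    using lborel_pair.integral_fst[of "\<lambda>x y. indicator (Omega L1 L2) (x, y) * wy (x, y)"] int[OF cont(2)]
    by (simp add: lborel_prod set_lebesgue_integral_def split_def)
  also have "\<dots> = (\<integral>x. indicator {0<..<L1} x * (\<integral>y. indicator {0<..<L2} y * wy (x, y) \<partial>lborel) \<partial>lborel)"
    unfolding ind by (simp add: mult_ac flip: integral_mult_right_zero)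
  also have "\<dots> = (\<integral>x. 0 \<partial>(lborel :: real measure))"
    unfolding iy using zero[of _ North] zero[of _ South]
    by (intro Bochner_Integration.integral_cong) (auto simp: indicator_def)
  finally show "(LINT p:Omega L1 L2|lborel. wy p) = 0" by simp
qed

text \<open>The integrand is the divergence of the field \<open>(lam v \<phi>, v \<phi>)\<close>, so
  only boundary values of the product matter. The condition on the product covers both uses:
  \<open>\<phi>\<close> supported in the open rectangle for the weak equation, and \<open>v\<close>
  zero on one side with \<open>\<phi>\<close> zero on the others for the trace.\<close>

lemma green_smooth:
  assumes "L1 > 0" "L2 > 0" and v: "smooth2 v" and \<phi>: "smooth2 \<phi>"
    and zero: "\<And>s p. p \<in> side_set L1 L2 s \<Longrightarrow> v p * \<phi> p = 0"
  shows "(LINT p:Omega L1 L2|lborel. v p * (lam * dx \<phi> p + dy \<phi> p) + (lam * dx v p + dy v p) * \<phi> p) = 0"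
proof -
  note dv = smooth2_has_derivative[OF v] and d\<phi> = smooth2_has_derivative[OF \<phi>]
  define wx where "wx p = v p * dx \<phi> p + dx v p * \<phi> p" for p
  define wy where "wy p = v p * dy \<phi> p + dy v p * \<phi> p" for p
  have c: "continuous_on UNIV wx" "continuous_on UNIV wy"
    unfolding wx_def[abs_def] wy_def[abs_def] by (intro continuous_intros dv d\<phi>)+
  have d: "((\<lambda>p. v p * \<phi> p) has_derivative (\<lambda>h. fst h * wx p + snd h * wy p)) (at p)" for p
    by (rule has_derivative_eq_rhs[OF has_derivative_mult[OF dv(1) d\<phi>(1)]])
      (simp add: fun_eq_iff wx_def wy_def algebra_simps)
  have "(LINT p:Omega L1 L2|lborel. v p * (lam * dx \<phi> p + dy \<phi> p) + (lam * dx v p + dy v p) * \<phi> p)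
     = (LINT p:Omega L1 L2|lborel. lam * wx p + wy p)"
    by (simp add: wx_def wy_def algebra_simps)
  also have "\<dots> = lam * (LINT p:Omega L1 L2|lborel. wx p) + (LINT p:Omega L1 L2|lborel. wy p)"
    using set_integrable_Omega_continuous[OF c(1), of L1 L2] set_integrable_Omega_continuous[OF c(2), of L1 L2] by simp
  also have "\<dots> = 0"
    using integral_dx_dy_eq_0[OF assms(1,2) d c zero] by simp
  finally show ?thesis .
qed

text \<open>The approximation is \<open>v = conv (tensor f k) U\<close>. On the rectangle
  \<open>lam v\<^sub>x + v\<^sub>y\<close> equals the convolution of \<open>G\<close> with the same
  kernel, so both errors are mollification errors, of \<open>U\<close> and of
  \<open>G\<close>.\<close>

lemma scalar_approximation:
  fixes u g :: "real \<times> real \<Rightarrow> real" and L1 L2 :: real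
  defines "U \<equiv> \<lambda>p. indicator (Omega L1 L2) p * u p" and "G \<equiv> \<lambda>p. indicator (Omega L1 L2) p * g p"
  assumes sx: "sx \<in> {West, East}" and sy: "sy \<in> {South, North}"
    and tzx: "trace_zero L1 L2 lam u g sx" and tzy: "trace_zero L1 L2 lam u g sy"
    and Um: "U \<in> borel_measurable borel" and U2: "integrable lborel (\<lambda>p. (U p)\<^sup>2)"
    and Gm: "G \<in> borel_measurable borel" and G2: "integrable lborel (\<lambda>p. (G p)\<^sup>2)"
    and "e > 0"
  obtains v N where "smooth2 v" "open N" "side_set L1 L2 sx \<union> side_set L1 L2 sy \<subseteq> N" "\<And>p. p \<in> N \<Longrightarrow> v p = 0"
    "set_integrable lborel (Omega L1 L2) (\<lambda>p. (u p - v p)\<^sup>2)"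
    "(LINT p:Omega L1 L2|lborel. (u p - v p)\<^sup>2) < e"
    "set_integrable lborel (Omega L1 L2) (\<lambda>p. (g p - (lam * dx v p + dy v p))\<^sup>2)"
    "(LINT p:Omega L1 L2|lborel. (g p - (lam * dx v p + dy v p))\<^sup>2) < e"
proof -
  have out: "U p = 0" "G p = 0" if "p \<notin> Omega L1 L2" for p using that by (simp_all add: U_def G_def)
  have U: "integrable lborel U" and G: "integrable lborel G"
    using integrable_if_square_integrable[OF Um U2 bounded_Omega] integrable_if_square_integrable[OF Gm G2 bounded_Omega] out by blast+
  have fin: "emeasure lborel (Omega L1 L2) < \<infinity>" by (rule emeasure_bounded_finite[OF bounded_Omega])
  obtain d1 where d1: "d1 > 0" "\<And>K. mollifier K d1 \<Longrightarrow> set_integrable lborel (Omega L1 L2) (\<lambda>p. (U p - conv K U p)\<^sup>2) \<and>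
      (LINT p:Omega L1 L2|lborel. (U p - conv K U p)\<^sup>2) < e"
    using mollify_L2_tendsto[OF Um U2 bounded_Omega out(1) Omega_sets fin \<open>e > 0\<close>] by blast
  obtain d2 where d2: "d2 > 0" "\<And>K. mollifier K d2 \<Longrightarrow> set_integrable lborel (Omega L1 L2) (\<lambda>p. (G p - conv K G p)\<^sup>2) \<and>
      (LINT p:Omega L1 L2|lborel. (G p - conv K G p)\<^sup>2) < e"
    using mollify_L2_tendsto[OF Gm G2 bounded_Omega out(2) Omega_sets fin \<open>e > 0\<close>] by blast
  \<comment> \<open>The kernel has radius \<open>5 * r\<close>, which must not exceed
    \<open>d1\<close> or \<open>d2\<close>.\<close>
  define r where "r = min d1 d2 / 5"
  have r: "r > 0" using d1 d2 by (simp add: r_def)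
  define I where "I s = {t. inward s * t \<in> {r..2 * r}}" for s
  obtain f where f: "test_fun f (I sx)" "\<And>t. f t \<ge> 0" "has_bochner_integral lborel f 1"
    using kernel_exists[OF r abs_inward(1)[of sx]] unfolding I_def by metis
  obtain k where k: "test_fun k (I sy)" "\<And>t. k t \<ge> 0" "has_bochner_integral lborel k 1"
    using kernel_exists[OF r abs_inward(1)[of sy]] unfolding I_def by metis
  have sm: "smooth1 f" "smooth1 k" using f k by (auto simp: test_fun_def)
  have "mollifier (tensor f k) (5 * r)"
    by (rule mollifier_tensor) (use f k r in \<open>auto simp: I_def\<close>)
  then interpret m: mollifier "tensor f k" "5 * r" .
  \<comment> \<open>The support condition of the locale becomes weaker as the radius grows, so one
    kernel serves for both functions.\<close>
  have "mollifier (tensor f k) d1" "mollifier (tensor f k) d2"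
    using m.mollifier_axioms unfolding mollifier_def r_def by auto
  note close = conjunct1[OF d1(2)[OF this(1)]] conjunct2[OF d1(2)[OF this(1)]]
    conjunct1[OF d2(2)[OF this(2)]] conjunct2[OF d2(2)[OF this(2)]]
  define v where "v = conv (tensor f k) U"
  \<comment> \<open>Two open half-planes, each extending a distance \<open>r\<close> past its side
    into the rectangle.\<close>
  define N where "N = {p. inward sx * (fst p - side_pos L1 L2 sx) < r \<or> inward sy * (snd p - side_pos L1 L2 sy) < r}"
  have sub: "side_set L1 L2 sx \<union> side_set L1 L2 sy \<subseteq> N"
    using side_set_pos(1)[OF sx] side_set_pos(2)[OF sy] r by (fastforce simp: N_def)
  have "open N"
    unfolding N_def by (intro open_Collect_disj open_Collect_less continuous_intros)
  have vN: "v p = 0" if "p \<in> N" for p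
  proof -
    have "tensor f k (p - q) * U q = 0" for q
    proof (rule ccontr)
      assume *: "tensor f k (p - q) * U q \<noteq> 0"
      then have "fst p - fst q \<in> I sx" "snd p - snd q \<in> I sy"
        using f(1) k(1) by (auto simp: tensor_def test_fun_def)
      then have "inward sx * (fst p - fst q) \<ge> r" "inward sy * (snd p - snd q) \<ge> r" by (auto simp: I_def)
      moreover have "q \<in> Omega L1 L2" using * out by fastforce
      \<comment> \<open>From \<open>q\<close> in the rectangle, where both inward distances are
        positive, \<open>p\<close> is reached by moving at least \<open>r\<close> along each inner
        normal. So both inward distances of \<open>p\<close> exceed \<open>r\<close>.\<close>
      ultimately show False
        using that inward_pos_if_in_Omega[of q L1 L2] sx sy by (fastforce simp: N_def algebra_simps)
    qed
    then show ?thesis unfolding v_def conv_def by (simp only:) simp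
  qed
  have v: "smooth2 v" unfolding v_def by (rule smooth2_conv_tensor[OF f(1) k(1) U])
  have dv: "dx v p = conv (tensor (deriv f) k) U p" "dy v p = conv (tensor f (deriv k)) U p" for p
    using dx_eqI[OF conv_tensor_has_derivative[OF f(1) k(1) U]] by (auto simp: v_def)
  \<comment> \<open>The test function is the reflected kernel
    \<open>q \<mapsto> tensor f k (p - q)\<close>. The identity is proved for \<open>p\<close> in
    the rectangle, which suffices because the errors are integrated there.\<close>
  have eq: "conv (tensor f k) G p = lam * dx v p + dy v p" if p: "p \<in> Omega L1 L2" for p
  proof -
    define f' where "f' x = f (fst p - x)" for x
    define k' where "k' x = k (snd p - x)" for x
    have refl: "smooth1 (\<lambda>x. h (c - x))" "deriv (\<lambda>x. h (c - x)) = (\<lambda>x. - deriv h (c - x))" if "smooth1 h" for h c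
    proof -
      show "smooth1 (\<lambda>x. h (c - x))" using smooth1_affine[OF that, of 1 "-1" c] by simp
      show "deriv (\<lambda>x. h (c - x)) = (\<lambda>x. - deriv h (c - x))"
      proof (intro ext DERIV_imp_deriv)
        fix x
        have "((\<lambda>x. h (c - x)) has_real_derivative deriv h (c - x) * (-1)) (at x)"
          by (rule DERIV_chain2[OF smooth1_has_deriv[OF that]]) (auto intro!: derivative_eq_intros)
        then show "((\<lambda>x. h (c - x)) has_real_derivative - deriv h (c - x)) (at x)" by simp
      qed
    qed
    have tr: "test_fun (\<lambda>x. h (c - x)) ((\<lambda>t. c - t) ` A)" if "test_fun h A" for h c A
      using that refl(1)[of h c] unfolding test_fun_def
      by (auto intro!: compact_continuous_image continuous_intros)
        (metis diff_diff_eq2 add_diff_cancel_left' image_eqI)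
    have tf: "test_fun f' ((\<lambda>t. fst p - t) ` I sx)" "test_fun k' ((\<lambda>t. snd p - t) ` I sy)"
      unfolding f'_def[abs_def] k'_def[abs_def] using f k by (auto intro: tr)
    \<comment> \<open>The reflected kernel extends from \<open>p\<close> against the inner normals,
      that is, away from the opposite sides; since \<open>p\<close> is inside, it misses them for
      every \<open>r\<close>.\<close>
    have far: "side_pos L1 L2 (opposite sx) \<notin> (\<lambda>t. fst p - t) ` I sx"
      "side_pos L1 L2 (opposite sy) \<notin> (\<lambda>t. snd p - t) ` I sy"
      using sx sy p r by (auto simp: Omega_def I_def)
    have "green lam U G f' k' = 0"
      unfolding U_def G_def
      by (rule green_adjacent[OF sx sy tzx tzy tf(1) far(1) tf(2) far(2)])
        (use U G U2 G2 in \<open>simp_all add: U_def G_def\<close>)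
    \<comment> \<open>Reflection reverses the sign of the first-order terms, so Green's identity in
      \<open>q\<close> becomes the differential equation in \<open>p\<close>.\<close>
    moreover have "green lam U G f' k' = (\<integral>q. tensor f k (p - q) * G q -
        (lam * (tensor (deriv f) k (p - q) * U q) + tensor f (deriv k) (p - q) * U q) \<partial>lborel)"
      unfolding green_def using refl(2)[OF sm(1), of "fst p"] refl(2)[OF sm(2), of "snd p"]
      by (intro Bochner_Integration.integral_cong)
        (auto simp: tensor_def f'_def[abs_def] k'_def[abs_def] algebra_simps)
    moreover have "\<dots> = conv (tensor f k) G p - (lam * dx v p + dy v p)"
      unfolding dv using integrable_conv_tensor[OF f(1) k(1) G, of p]
        integrable_conv_tensor[OF test_fun_deriv[OF f(1)] k(1) U, of p]
        integrable_conv_tensor[OF f(1) test_fun_deriv[OF k(1)] U, of p]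
      by (simp add: conv_def)
    ultimately show ?thesis by simp
  qed
  have c1: "indicator (Omega L1 L2) p *\<^sub>R (U p - conv (tensor f k) U p)\<^sup>2 = indicator (Omega L1 L2) p *\<^sub>R (u p - v p)\<^sup>2" for p
    by (simp add: indicator_def U_def v_def)
  have c2: "indicator (Omega L1 L2) p *\<^sub>R (G p - conv (tensor f k) G p)\<^sup>2
      = indicator (Omega L1 L2) p *\<^sub>R (g p - (lam * dx v p + dy v p))\<^sup>2" for p
    using eq[of p] by (simp add: indicator_def G_def)
  show thesis
    by (rule that[OF v \<open>open N\<close> sub vN])
      (use close in \<open>simp_all only: set_integrable_def set_lebesgue_integral_def c1 c2\<close>)
qed

subsection \<open>The system\<close>

lemma L2_on_continuous:
  fixes F :: "real \<times> real \<Rightarrow> real ^ 'n"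
  assumes "continuous_on UNIV F" shows "L2_on (Omega L1 L2) F"
proof -
  have "continuous_on UNIV (\<lambda>p. (norm (F p))\<^sup>2)"
    using assms by (intro continuous_intros)
  moreover have "F \<in> borel_measurable borel"
    using assms by (rule borel_measurable_continuous_onI)
  ultimately show ?thesis
    unfolding L2_on_def set_borel_measurable_def by (intro conjI set_integrable_Omega_continuous) simp_all
qed

lemma L2_on_linear:
  fixes F :: "real \<times> real \<Rightarrow> real ^ 'n" and l :: "real ^ 'n \<Rightarrow> real"
  assumes "L2_on (Omega L1 L2) F" and l: "bounded_linear l"
  shows "(\<lambda>p. indicator (Omega L1 L2) p * l (F p)) \<in> borel_measurable borel"
    and "integrable lborel (\<lambda>p. (indicator (Omega L1 L2) p * l (F p))\<^sup>2)"
proof -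
  let ?F = "\<lambda>p. indicator (Omega L1 L2) p *\<^sub>R F p"
  interpret l: bounded_linear l by fact
  have F: "?F \<in> borel_measurable borel"
    and int: "integrable lborel (\<lambda>p. indicator (Omega L1 L2) p * (norm (F p))\<^sup>2)"
    using assms by (simp_all add: L2_on_def set_borel_measurable_def set_integrable_def)
  \<comment> \<open>\<open>L2_on\<close> gives measurability only of the extension by zero; by
    linearity the indicator can be moved inside \<open>l\<close>.\<close>
  have eq: "(\<lambda>p. indicator (Omega L1 L2) p * l (F p)) = (\<lambda>p. l (?F p))"
    by (simp add: l.scaleR)
  have "l \<in> borel_measurable borel"
    by (intro borel_measurable_continuous_onI l.continuous_on continuous_on_id)
  then show m: "(\<lambda>p. indicator (Omega L1 L2) p * l (F p)) \<in> borel_measurable borel"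
    unfolding eq using F by (rule measurable_compose[rotated])
  obtain C where C: "\<And>x. norm (l x) \<le> norm x * C" using l.bounded by blast
  show "integrable lborel (\<lambda>p. (indicator (Omega L1 L2) p * l (F p))\<^sup>2)"
  proof (rule Bochner_Integration.integrable_bound)
    show "integrable lborel (\<lambda>p. C\<^sup>2 * (indicator (Omega L1 L2) p * (norm (F p))\<^sup>2))"
      using int by simp
    show "AE p in lborel. norm ((indicator (Omega L1 L2) p * l (F p))\<^sup>2) \<le> norm (C\<^sup>2 * (indicator (Omega L1 L2) p * (norm (F p))\<^sup>2))"
    proof (intro AE_I2)
      fix p
      have "(l (F p))\<^sup>2 \<le> (norm (F p) * C)\<^sup>2"
        using C[of "F p"] by (intro power2_le_iff_abs_le[THEN iffD2] order_trans[OF norm_ge_zero C]) simp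
      then show "norm ((indicator (Omega L1 L2) p * l (F p))\<^sup>2) \<le> norm (C\<^sup>2 * (indicator (Omega L1 L2) p * (norm (F p))\<^sup>2))"
        by (simp add: indicator_def power_mult_distrib mult.commute)
    qed
  qed (use m in simp)
qed

text \<open>Turns the errors of the scalar components into the error of the vector: \<open>B\<close>
  bounds the change of variables, and \<open>CARD('n)\<close> counts the components.\<close>

lemma LINT_norm_square_linear_le:
  fixes Z :: "real \<times> real \<Rightarrow> real ^ 'm" and l :: "real ^ 'n \<Rightarrow> real ^ 'm" and w :: "'n \<Rightarrow> real \<times> real \<Rightarrow> real"
  assumes Z: "\<And>p. Z p = l (\<chi> i. w i p)" and B: "\<And>x. norm (l x) \<le> norm x * B"
    and int: "\<And>i. set_integrable lborel S (\<lambda>p. (w i p)\<^sup>2)" and e: "\<And>i. (LINT p:S|lborel. (w i p)\<^sup>2) \<le> e"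
  shows "(LINT p:S|lborel. (norm (Z p))\<^sup>2) \<le> B\<^sup>2 * (real CARD('n) * e)"
proof -
  have le: "(norm (Z p))\<^sup>2 \<le> B\<^sup>2 * (\<Sum>i\<in>UNIV. (w i p)\<^sup>2)" for p
  proof -
    have "(norm (Z p))\<^sup>2 \<le> (norm (\<chi> i. w i p) * B)\<^sup>2"
      using B[of "\<chi> i. w i p"] unfolding Z by (intro power_mono) auto
    also have "\<dots> = B\<^sup>2 * (\<Sum>i\<in>UNIV. (w i p)\<^sup>2)"
      by (simp add: power_mult_distrib norm_vec_def L2_set_def sum_nonneg)
    finally show ?thesis .
  qed
  have int2: "set_integrable lborel S (\<lambda>p. \<Sum>i\<in>UNIV. (w i p)\<^sup>2)"
    using int unfolding set_integrable_def scaleR_sum_right by (intro Bochner_Integration.integrable_sum)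
  have "(LINT p:S|lborel. (norm (Z p))\<^sup>2) \<le> (LINT p:S|lborel. B\<^sup>2 * (\<Sum>i\<in>UNIV. (w i p)\<^sup>2))"
    unfolding set_lebesgue_integral_def
  \<comment> \<open>Integrability is required of the majorant only: if the left integrand is not
    integrable, its integral is 0 by convention.\<close>
  proof (rule integral_mono')
    show "integrable lborel (\<lambda>p. indicator S p *\<^sub>R (B\<^sup>2 * (\<Sum>i\<in>UNIV. (w i p)\<^sup>2)))"
      using set_integrable_mult_right[OF int2, of "B\<^sup>2"] unfolding set_integrable_def by simp
  qed (use le in \<open>auto simp: indicator_def sum_nonneg\<close>)
  also have "\<dots> = B\<^sup>2 * (\<Sum>i\<in>UNIV. (LINT p:S|lborel. (w i p)\<^sup>2))"
    unfolding set_integral_mult_right using int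
    unfolding set_lebesgue_integral_def set_integrable_def scaleR_sum_right
    by (simp only: Bochner_Integration.integral_sum)
  also have "\<dots> \<le> B\<^sup>2 * (real CARD('n) * e)"
    using e by (intro mult_left_mono sum_bounded_above) auto
  finally show ?thesis .
qed

lemma matrix_inv_vector_mult:
  fixes A :: "real ^ 'n ^ 'n"
  assumes "invertible A"
  shows "A *v (matrix_inv A *v x) = x" "matrix_inv A *v (A *v x) = x"
proof -
  have "A ** matrix_inv A = mat 1 \<and> matrix_inv A ** A = mat 1"
    using assms unfolding invertible_def matrix_inv_def by (rule someI_ex)
  then show "A *v (matrix_inv A *v x) = x" "matrix_inv A *v (A *v x) = x"
    by (simp_all add: matrix_vector_mul_assoc)
qed

lemma zero_on_sides_if_supp_in_Omega:
  assumes "supp \<phi> \<subseteq> Omega L1 L2" "p \<in> side_set L1 L2 s"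
  shows "\<phi> p = 0"
proof -
  have "p \<notin> Omega L1 L2" using assms(2) by (cases s) (auto simp: Omega_def)
  with assms(1) have "p \<notin> supp \<phi>" by blast
  then show ?thesis
    unfolding supp_def using closure_subset[of "{p. \<phi> p \<noteq> 0}"] by blast
qed

theorem theorem2p2:
  fixes L1 L2 :: real
    and lam :: "real ^ 'n"
    and M1 M2 Q :: "real ^ 'n ^ 'n"
    and Gam :: "'n \<Rightarrow> side set"
  assumes "L1 > 0" and "L2 > 0"
    and "\<forall>i. lam $ i \<noteq> 0"
    and "invertible M1" and "invertible M2" and "invertible Q"
    and "matrix_inv Q ** diag_mat lam ** Q = matrix_inv M2 ** M1"
    and "\<forall>i. (lam $ i > 0 \<longrightarrow> Gam i = {West, South} \<or> Gam i = {East, North}) \<and>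
             (lam $ i < 0 \<longrightarrow> Gam i = {West, North} \<or> Gam i = {East, South})"
  shows "\<forall>Th G. inX L1 L2 M1 M2 Q lam Gam Th G \<longrightarrow>
           (\<forall>\<epsilon>>0. \<exists>Ph H. inV L1 L2 Q Gam Ph \<and> inX L1 L2 M1 M2 Q lam Gam Ph H \<and>
              sqrt ((LINT p:Omega L1 L2|lborel. (norm (Th p - Ph p))\<^sup>2) +
                    (LINT p:Omega L1 L2|lborel. (norm (G p - H p))\<^sup>2)) < \<epsilon>)"
proof (intro allI impI)
  fix Th G :: "real \<times> real \<Rightarrow> real ^ 'n" and \<epsilon> :: real
  assume X: "inX L1 L2 M1 M2 Q lam Gam Th G" and "\<epsilon> > 0"
  \<comment> \<open>The maps back from the scalar unknowns: \<open>l1\<close> recovers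
    \<open>Th\<close> from the \<open>u i\<close>, and \<open>l2\<close> recovers \<open>G\<close>
    from the \<open>g i\<close>. The relation between the matrices becomes
    \<open>M1 l1 = l2 \<Lambda>\<close>, while \<open>M2 l1 = l2\<close> by definition.\<close>
  define l1 where "l1 x = matrix_inv Q *v x" for x
  define l2 where "l2 x = M2 *v (matrix_inv Q *v x)" for x
  have l1: "bounded_linear l1" and l2: "bounded_linear l2"
    unfolding l1_def[abs_def] l2_def[abs_def]
    by (auto intro: bounded_linear_compose matrix_vector_mul_bounded_linear)
  have Ql1: "Q *v l1 x = x" and l1Q: "l1 (Q *v x) = x" for x
    using assms by (simp_all add: l1_def matrix_inv_vector_mult)
  have Ql2: "Q *v (matrix_inv M2 *v l2 x) = x" and l2Q: "l2 (Q *v (matrix_inv M2 *v x)) = x" for x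
    using assms by (simp_all add: l2_def matrix_inv_vector_mult)
  have M2l1: "M2 *v l1 x = l2 x" for x by (simp add: l1_def l2_def)
  have M1l1: "M1 *v l1 x = l2 (\<chi> i. lam $ i * x $ i)" for x
  proof -
    have "diag_mat lam *v x = (\<chi> i. lam $ i * x $ i)"
      by (simp add: diag_mat_def matrix_vector_mult_def vec_eq_iff if_distribR if_distrib[of "\<lambda>a. a * _"] cong: if_cong)
    then have "l2 (\<chi> i. lam $ i * x $ i) = M2 *v ((matrix_inv Q ** diag_mat lam ** Q) *v l1 x)"
      by (simp add: l2_def Ql1 flip: matrix_vector_mul_assoc)
    also have "\<dots> = M1 *v l1 x"
      using assms by (simp add: matrix_inv_vector_mult flip: matrix_vector_mul_assoc)
    finally show ?thesis by simp
  qed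
  obtain B1 where B1: "\<And>x. norm (l1 x) \<le> norm x * B1" using bounded_linear.bounded[OF l1] by blast
  obtain B2 where B2: "\<And>x. norm (l2 x) \<le> norm x * B2" using bounded_linear.bounded[OF l2] by blast
  define n where "n = real CARD('n)"
  have "n > 0" by (simp add: n_def)
  \<comment> \<open>The total squared error will be at most
    \<open>(B1\<^sup>2 + B2\<^sup>2) * (n * e)\<close>. The added 1 makes this strictly less than
    \<open>\<epsilon>\<^sup>2\<close> and keeps the denominator positive.\<close>
  define e where "e = \<epsilon>\<^sup>2 / ((B1\<^sup>2 + B2\<^sup>2 + 1) * n)"
  have Bpos: "B1\<^sup>2 + B2\<^sup>2 + 1 > 0" by (simp add: add_nonneg_pos)
  have "e > 0" unfolding e_def using \<open>\<epsilon> > 0\<close> \<open>n > 0\<close> Bpos by (intro divide_pos_pos mult_pos_pos) auto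
  define u where "u i p = (Q *v Th p) $ i" for i p
  define g where "g i p = (Q *v (matrix_inv M2 *v G p)) $ i" for i p
  have ThG: "L2_on (Omega L1 L2) Th" "L2_on (Omega L1 L2) G"
    and tz: "\<And>i s. s \<in> Gam i \<Longrightarrow> trace_zero L1 L2 (lam $ i) (u i) (g i) s"
    using X unfolding inX_def u_def g_def by auto
  have bl: "bounded_linear (\<lambda>x. (Q *v x) $ i)" "bounded_linear (\<lambda>x. (Q *v (matrix_inv M2 *v x)) $ i)" for i
    by (auto intro!: bounded_linear_compose[OF bounded_linear_vec_nth] bounded_linear_compose[OF matrix_vector_mul_bounded_linear] matrix_vector_mul_bounded_linear)
  define app where "app i v N \<longleftrightarrow> smooth2 v \<and> open N \<and> (\<Union>s\<in>Gam i. side_set L1 L2 s) \<subseteq> N \<and> (\<forall>p\<in>N. v p = 0) \<and>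
    set_integrable lborel (Omega L1 L2) (\<lambda>p. (u i p - v p)\<^sup>2) \<and>
    (LINT p:Omega L1 L2|lborel. (u i p - v p)\<^sup>2) < e \<and>
    set_integrable lborel (Omega L1 L2) (\<lambda>p. (g i p - (lam $ i * dx v p + dy v p))\<^sup>2) \<and>
    (LINT p:Omega L1 L2|lborel. (g i p - (lam $ i * dx v p + dy v p))\<^sup>2) < e" for i v N
  have "\<exists>v N. app i v N" for i
  proof -
    \<comment> \<open>Each of the four admissible \<open>Gam i\<close> consists of one vertical and
      one horizontal side, which therefore meet in a corner.\<close>
    obtain sx sy where s: "sx \<in> {West, East}" "sy \<in> {South, North}" "Gam i = {sx, sy}"
      using assms(3,8) by (metis insertCI linorder_neqE_linordered_idom)
    have "trace_zero L1 L2 (lam $ i) (u i) (g i) sx" "trace_zero L1 L2 (lam $ i) (u i) (g i) sy"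
      using tz s by auto
    from scalar_approximation[OF s(1,2) this L2_on_linear[OF ThG(1) bl(1)[of i], folded u_def]
        L2_on_linear[OF ThG(2) bl(2)[of i], folded g_def] \<open>e > 0\<close>]
    obtain v N where "smooth2 v" "open N" "side_set L1 L2 sx \<union> side_set L1 L2 sy \<subseteq> N" "\<And>p. p \<in> N \<Longrightarrow> v p = 0"
      "set_integrable lborel (Omega L1 L2) (\<lambda>p. (u i p - v p)\<^sup>2)"
      "(LINT p:Omega L1 L2|lborel. (u i p - v p)\<^sup>2) < e"
      "set_integrable lborel (Omega L1 L2) (\<lambda>p. (g i p - (lam $ i * dx v p + dy v p))\<^sup>2)"
      "(LINT p:Omega L1 L2|lborel. (g i p - (lam $ i * dx v p + dy v p))\<^sup>2) < e"
      by blast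
    then show ?thesis unfolding app_def s(3) by (intro exI[of _ v] exI[of _ N]) auto
  qed
  then obtain v N where app: "\<And>i. app i (v i) (N i)" by metis
  then have v: "\<And>i. smooth2 (v i)" and N: "\<And>i. open (N i)" "\<And>i. (\<Union>s\<in>Gam i. side_set L1 L2 s) \<subseteq> N i" "\<And>i p. p \<in> N i \<Longrightarrow> v i p = 0"
    unfolding app_def by auto
  define h where "h i p = lam $ i * dx (v i) p + dy (v i) p" for i p
  define Ph where "Ph p = l1 (\<chi> i. v i p)" for p
  define H where "H p = l2 (\<chi> i. h i p)" for p
  have cont: "continuous_on UNIV (v i)" "continuous_on UNIV (h i)" for i
    unfolding h_def[abs_def] by (intro continuous_intros smooth2_has_derivative v)+
  have contv: "continuous_on UNIV (\<lambda>p. \<chi> i. v i p)" and conth: "continuous_on UNIV (\<lambda>p. \<chi> i. h i p)"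
    by (intro continuous_on_vec_lambda cont)+
  have Ph: "continuous_on UNIV Ph" and H: "continuous_on UNIV H"
    unfolding Ph_def[abs_def] H_def[abs_def]
    using bounded_linear.continuous_on[OF l1 contv] bounded_linear.continuous_on[OF l2 conth] by simp_all
  have "inV L1 L2 Q Gam Ph"
    unfolding inV_def
  proof (intro conjI allI)
    have "(\<lambda>p. Ph p $ j) = (\<lambda>p. \<Sum>i\<in>UNIV. matrix_inv Q $ j $ i * v i p)" for j
      by (simp add: Ph_def l1_def matrix_vector_mult_def)
    then show "smooth2_vec Ph"
      unfolding smooth2_vec_def using smooth2_lincomb[of v, OF v] by simp
    show "\<exists>U. open U \<and> (\<Union>s\<in>Gam i. side_set L1 L2 s) \<subseteq> U \<and> (\<forall>p\<in>U \<inter> OmegaBar L1 L2. (Q *v Ph p) $ i = 0)" for i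
      using N(1)[of i] N(2)[of i] N(3) by (intro exI[of _ "N i"]) (simp add: Ph_def Ql1)
  qed
  moreover have "inX L1 L2 M1 M2 Q lam Gam Ph H"
    unfolding inX_def
  proof (intro conjI allI ballI)
    show "L2_on (Omega L1 L2) Ph" "L2_on (Omega L1 L2) H" by (intro L2_on_continuous Ph H)+
    show "weak_op L1 L2 M1 M2 Ph H"
      unfolding weak_op_def
    proof (intro allI impI)
      fix \<phi> assume \<phi>: "smooth2 \<phi> \<and> compact (supp \<phi>) \<and> supp \<phi> \<subseteq> Omega L1 L2"
      then have sm\<phi>: "smooth2 \<phi>" by blast
      note c\<phi> = smooth2_has_derivative(2-4)[OF sm\<phi>, of UNIV]
      \<comment> \<open>Component \<open>i\<close> is the Green integrand of \<open>v i\<close>, and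
        \<open>l2\<close> maps the vector to the integrand of the weak system. The weak equation is
        thus the image under \<open>l2\<close> of scalar identities.\<close>
      let ?F = "\<lambda>p. \<chi> i. v i p * (lam $ i * dx \<phi> p + dy \<phi> p) + h i p * \<phi> p"
      have intF: "set_integrable lborel (Omega L1 L2) ?F"
        by (intro set_integrable_Omega_continuous continuous_on_vec_lambda continuous_intros cont c\<phi>)
      have "(LINT p:Omega L1 L2|lborel. ?F p) $ i = (LINT p:Omega L1 L2|lborel. ?F p $ i)" for i
        using integral_bounded_linear[OF bounded_linear_vec_nth[of i] intF[unfolded set_integrable_def]]
        unfolding set_lebesgue_integral_def by simp
      also have "\<dots> i = 0" for i
        using green_smooth[OF assms(1,2) v[of i] sm\<phi>, of "lam $ i"] zero_on_sides_if_supp_in_Omega[of \<phi> L1 L2] \<phi>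
        by (simp add: h_def)
      finally have F0: "(LINT p:Omega L1 L2|lborel. ?F p) = 0" by (simp add: vec_eq_iff)
      have split: "l2 (?F p) = \<phi> p *\<^sub>R H p + (dx \<phi> p *\<^sub>R (M1 *v Ph p) + dy \<phi> p *\<^sub>R (M2 *v Ph p))" for p
      proof -
        have "?F p = \<phi> p *\<^sub>R (\<chi> i. h i p) + (dx \<phi> p *\<^sub>R (\<chi> i. lam $ i * v i p) + dy \<phi> p *\<^sub>R (\<chi> i. v i p))"
          by (simp add: vec_eq_iff algebra_simps)
        then show ?thesis
          by (simp add: linear_add[OF bounded_linear.linear[OF l2]] linear_scale[OF bounded_linear.linear[OF l2]]
              H_def Ph_def M1l1 M2l1)
      qed
      have "(LINT p:Omega L1 L2|lborel. \<phi> p *\<^sub>R H p) +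
          (LINT p:Omega L1 L2|lborel. dx \<phi> p *\<^sub>R (M1 *v Ph p) + dy \<phi> p *\<^sub>R (M2 *v Ph p)) =
          (LINT p:Omega L1 L2|lborel. l2 (?F p))"
        unfolding split
        by (intro set_integral_add(2)[symmetric] set_integrable_Omega_continuous continuous_intros c\<phi> H
            bounded_linear.continuous_on[OF matrix_vector_mul_bounded_linear] Ph)
      also have "\<dots> = l2 (LINT p:Omega L1 L2|lborel. ?F p)"
        using integral_bounded_linear[OF l2 intF[unfolded set_integrable_def]]
        unfolding set_lebesgue_integral_def by (simp add: linear_scale[OF bounded_linear.linear[OF l2]])
      also have "\<dots> = 0" unfolding F0 by (rule linear_0[OF bounded_linear.linear[OF l2]])
      finally show "(LINT p:Omega L1 L2|lborel. \<phi> p *\<^sub>R H p) =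
          - (LINT p:Omega L1 L2|lborel. dx \<phi> p *\<^sub>R (M1 *v Ph p) + dy \<phi> p *\<^sub>R (M2 *v Ph p))"
        by (simp add: eq_neg_iff_add_eq_0)
    qed
    fix i s assume s: "s \<in> Gam i"
    show "trace_zero L1 L2 (lam $ i) (\<lambda>p. (Q *v Ph p) $ i) (\<lambda>p. (Q *v (matrix_inv M2 *v H p)) $ i) s"
      unfolding trace_zero_def
    proof (intro allI impI)
      fix \<phi> assume \<phi>: "smooth2 \<phi> \<and> compact (supp \<phi>) \<and> supp \<phi> \<inter> (\<Union>s'\<in>UNIV - {s}. side_set L1 L2 s') = {}"
      \<comment> \<open>On \<open>s\<close> the factor \<open>v i\<close> vanishes because
        \<open>N i\<close> covers that side; on the other three \<open>\<phi>\<close> vanishes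
        because its support misses them.\<close>
      have "v i p * \<phi> p = 0" if "p \<in> side_set L1 L2 s'" for s' p
      proof (cases "s' = s")
        case True
        then have "p \<in> N i" using N(2)[of i] s that by blast
        then show ?thesis by (simp add: N(3))
      next
        case False
        then have "p \<notin> supp \<phi>" using \<phi> that by blast
        then show ?thesis unfolding supp_def using closure_subset[of "{p. \<phi> p \<noteq> 0}"] by auto
      qed
      then show "(LINT p:Omega L1 L2|lborel. (Q *v Ph p) $ i * (lam $ i * dx \<phi> p + dy \<phi> p) +
          (Q *v (matrix_inv M2 *v H p)) $ i * \<phi> p) = 0"
        using green_smooth[OF assms(1,2) v[of i], of \<phi> "lam $ i"] \<phi> by (simp add: Ph_def H_def Ql1 Ql2 h_def)
    qed
  qed
  moreover have "sqrt ((LINT p:Omega L1 L2|lborel. (norm (Th p - Ph p))\<^sup>2) +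
      (LINT p:Omega L1 L2|lborel. (norm (G p - H p))\<^sup>2)) < \<epsilon>"
  proof -
    have diff1: "Th p - Ph p = l1 (\<chi> i. u i p - v i p)" for p
    proof -
      have "(\<chi> i. u i p - v i p) = Q *v Th p - (\<chi> i. v i p)" by (simp add: vec_eq_iff u_def)
      then show ?thesis by (simp add: linear_diff[OF bounded_linear.linear[OF l1]] l1Q Ph_def)
    qed
    have diff2: "G p - H p = l2 (\<chi> i. g i p - h i p)" for p
    proof -
      have "(\<chi> i. g i p - h i p) = Q *v (matrix_inv M2 *v G p) - (\<chi> i. h i p)" by (simp add: vec_eq_iff g_def)
      then show ?thesis by (simp add: linear_diff[OF bounded_linear.linear[OF l2]] l2Q H_def)
    qed
    have "(LINT p:Omega L1 L2|lborel. (norm (Th p - Ph p))\<^sup>2) \<le> B1\<^sup>2 * (n * e)"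
      unfolding n_def by (rule LINT_norm_square_linear_le[OF diff1 B1]) (use app in \<open>auto simp: app_def intro: less_imp_le\<close>)
    moreover have "(LINT p:Omega L1 L2|lborel. (norm (G p - H p))\<^sup>2) \<le> B2\<^sup>2 * (n * e)"
      unfolding n_def by (rule LINT_norm_square_linear_le[OF diff2 B2]) (use app in \<open>auto simp: app_def h_def intro: less_imp_le\<close>)
    ultimately have "(LINT p:Omega L1 L2|lborel. (norm (Th p - Ph p))\<^sup>2) +
      (LINT p:Omega L1 L2|lborel. (norm (G p - H p))\<^sup>2) \<le> (B1\<^sup>2 + B2\<^sup>2) * (n * e)"
      by (simp add: algebra_simps)
    also have "\<dots> < (B1\<^sup>2 + B2\<^sup>2 + 1) * (n * e)"
      using \<open>n > 0\<close> \<open>e > 0\<close> by (intro mult_strict_right_mono) auto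
    also have "\<dots> = \<epsilon>\<^sup>2"
      using \<open>n > 0\<close> Bpos by (simp add: e_def)
    finally show ?thesis
      using \<open>\<epsilon> > 0\<close> by (intro real_less_lsqrt) auto
  qed
  ultimately show "\<exists>Ph H. inV L1 L2 Q Gam Ph \<and> inX L1 L2 M1 M2 Q lam Gam Ph H \<and>
      sqrt ((LINT p:Omega L1 L2|lborel. (norm (Th p - Ph p))\<^sup>2) +
            (LINT p:Omega L1 L2|lborel. (norm (G p - H p))\<^sup>2)) < \<epsilon>"
    by blast
qed

end
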